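(* Let $K\ge 3$ be an integer and let $\theta=\theta_K\in(0,\frac{\pi}{4})$ be a parameter such that, for $F=F_{\theta_K}$, $F^k(\overline{E_1P_4})\subset\mathcal B_1$ for $0\le k<K$ and $F^K(\overline{E_1P_4})=\overline{E_1P_1}$. Let $\Gamma_K^0=\bigcup_{i=0}^{4K-1}\overline{F^i(P_4)F^{i+1}(P_4)}$, which is a rotationally symmetric invariant circle of $F$ containing all the points $P_i$ and $P_i'$, $i\in\{1,2,3,4\}$. Then the annulus between $\partial\mathcal S$ and $\Gamma_K^0$ is completely foliated by rotationally symmetric invariant circles of $F$, with rotation numbers continuously and monotonically varying from $0$ on $\partial\mathcal S$ to $\frac{1}{4K}$ on $\Gamma_K^0$.
   Context: The map $F_\theta$. Let $\mathcal S=[0,1]\times[0,1]$, $Z=(\frac12,\frac12)$, $E_1=(0,0)$, $E_2=(1,0)$, $E_3=(1,1)$, $E_4=(0,1)$. Indices $i\in\{1,2,3,4\}$ are cyclic. For $\theta\in(0,\frac{\pi}{4})$ let $L_i$ be the ray from $E_i$ into $\mathcal S$ making angle $\theta$ with the segment $\overline{E_iE_{i+1}}$, and $P_i=L_{i-1}\cap L_i$. With $t=\sin^2\theta$, $s=\sin\theta\cos\theta$ this gives $P_1=(s,t)$, $P_2=(1-t,s)$, $P_3=(1-s,1-t)$, $P_4=(t,1-s)$. Put $P_1'=(1-s,t)$, $P_2'=(1-t,1-s)$, $P_3'=(s,1-t)$, $P_4'=(t,s)$. The square $\mathcal S$ is partitioned (up to boundaries) into the closed triangles $\mathcal A_i=\Delta(E_i,E_{i+1},P_i)$,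 $\mathcal B_i=\Delta(E_i,P_i,P_{i-1})$ and the closed square $\mathcal C=\square(P_1,P_2,P_3,P_4)$. The map $F=F_\theta\colon\mathcal S\to\mathcal S$ is the unique map with $F(E_i)=E_i$, $F(P_i)=P_i'$ for all $i$ that is affine on each of the nine pieces $\mathcal A_i,\mathcal B_i,\mathcal C$; it is an orientation- and area-preserving homeomorphism of $\mathcal S$, equal to the identity on $\partial\mathcal S$. An invariant circle is a simple closed curve $\Gamma\subset\mathcal S$ with $F(\Gamma)=\Gamma$. Its rotation number $\rho_\Gamma\in[0,1)$ is the rotation number of the circle homeomorphism $F|_\Gamma$, with $\Gamma$ oriented counterclockwise. Let $R$ be the (counterclockwise) rotation about $Z$ by $\frac{\pi}{2}$. An invariant circle $\Gamma$ is rotationally symmetric if it encircles $Z$, $F|_\Gamma$ preserves the cyclic ($S^1$-)order of points of $\Gamma$, and $R(\Gamma)=\Gamma$. "The annulus $\mathbb A$ between $\partial\mathcal S$ and $\Gamma_K^0$ is completely foliated by invariant circles with rotation numbers continuously and monotonically varying from $a$ to $b$" means: there is a homeomorphism $h\colon S^1\times[0,1]\to\mathbb A$ (with $\mathbb A$ the closed annulus) with $h(S^1\times\{0\})=\partial\mathcal S$ and $h(S^1\times\{1\})=\Gamma_K^0$, such that every $h(S^1\times\{r\})$ is an invariant circle of the stated kind, and $r\mapsto\rho_{h(S^1\times\{r\})}$ is continuous and monotone on $[0,1]$ with values $a$ at $r=0$ and $b$ at $r=1$. *)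

theory Defs
  imports "HOL-Complex_Analysis.Complex_Analysis"
begin

text \<open>The plane is the type of complex numbers. The cyclic indices \<open>1, 2, 3, 4\<close> are natural
  numbers read modulo 4; in the lists below the entry with index 4 therefore comes first.\<close>

definition unit_square :: "complex set" where
  "unit_square = cbox (Complex 0 0) (Complex 1 1)"

definition center :: complex where
  "center = Complex (1/2) (1/2)"

definition E :: "nat \<Rightarrow> complex" where
  "E i = [Complex 0 1, Complex 0 0, Complex 1 0, Complex 1 1] ! (i mod 4)"

text \<open>The point \<open>P \<theta> i\<close> is the intersection of the rays \<open>L (i - 1)\<close> and \<open>L i\<close>, where \<open>L i\<close>
  starts at \<open>E i\<close>, points into the square and makes angle \<open>\<theta>\<close> with the side from \<open>E i\<close> to
  \<open>E (i + 1)\<close>.\<close>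

definition P :: "real \<Rightarrow> nat \<Rightarrow> complex" where
  "P \<theta> i = (let t = (sin \<theta>)\<^sup>2; s = sin \<theta> * cos \<theta> in
     [Complex t (1 - s), Complex s t, Complex (1 - t) s, Complex (1 - s) (1 - t)] ! (i mod 4))"

definition P' :: "real \<Rightarrow> nat \<Rightarrow> complex" where
  "P' \<theta> i = (let t = (sin \<theta>)\<^sup>2; s = sin \<theta> * cos \<theta> in
     [Complex t s, Complex (1 - s) t, Complex (1 - t) (1 - s), Complex s (1 - t)] ! (i mod 4))"

definition triangle_A :: "real \<Rightarrow> nat \<Rightarrow> complex set" where
  "triangle_A \<theta> i = convex hull {E i, E (i + 1), P \<theta> i}"

text \<open>To be used for \<open>i \<ge> 1\<close> only, since subtraction on natural numbers truncates.\<close>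

definition triangle_B :: "real \<Rightarrow> nat \<Rightarrow> complex set" where
  "triangle_B \<theta> i = convex hull {E i, P \<theta> i, P \<theta> (i - 1)}"

definition square_C :: "real \<Rightarrow> complex set" where
  "square_C \<theta> = convex hull {P \<theta> 1, P \<theta> 2, P \<theta> 3, P \<theta> 4}"

definition affine_map_on :: "complex set \<Rightarrow> (complex \<Rightarrow> complex) \<Rightarrow> bool" where
  "affine_map_on X f \<longleftrightarrow> (\<exists>l c. linear l \<and> (\<forall>z\<in>X. f z = l z + c))"

text \<open>\<open>is_F \<theta> F\<close> says that \<open>F\<close> agrees with \<open>F\<^sub>\<theta>\<close> on the unit square; the values of \<open>F\<close> outside
  the square are arbitrary and never matter.\<close>

definition is_F :: "real \<Rightarrow> (complex \<Rightarrow> complex) \<Rightarrow> bool" where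
  "is_F \<theta> F \<longleftrightarrow>
     (\<forall>i\<in>{1..4}. F (E i) = E i \<and> F (P \<theta> i) = P' \<theta> i) \<and>
     (\<forall>i\<in>{1..4}. affine_map_on (triangle_A \<theta> i) F \<and> affine_map_on (triangle_B \<theta> i) F) \<and>
     affine_map_on (square_C \<theta>) F"

definition simple_closed_curve :: "complex set \<Rightarrow> bool" where
  "simple_closed_curve \<Gamma> \<longleftrightarrow>
     (\<exists>g. simple_path g \<and> pathfinish g = pathstart g \<and> path_image g = \<Gamma>)"

definition invariant_circle :: "(complex \<Rightarrow> complex) \<Rightarrow> complex set \<Rightarrow> bool" where
  "invariant_circle F \<Gamma> \<longleftrightarrow> simple_closed_curve \<Gamma> \<and> \<Gamma> \<subseteq> unit_square \<and> F ` \<Gamma> = \<Gamma>"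

definition ccw_param :: "complex set \<Rightarrow> (real \<Rightarrow> complex) \<Rightarrow> bool" where
  "ccw_param \<Gamma> g \<longleftrightarrow>
     simple_path g \<and> pathfinish g = pathstart g \<and> path_image g = \<Gamma> \<and>
     (\<forall>z\<in>inside \<Gamma>. winding_number g z = 1)"

text \<open>Travelling once counterclockwise around \<open>\<Gamma>\<close> from \<open>x\<close>, one meets \<open>y\<close> and then \<open>z\<close>
  (three distinct points).\<close>

definition cyclic_order :: "complex set \<Rightarrow> complex \<Rightarrow> complex \<Rightarrow> complex \<Rightarrow> bool" where
  "cyclic_order \<Gamma> x y z \<longleftrightarrow>
     (\<exists>g b c. ccw_param \<Gamma> g \<and> 0 < b \<and> b < c \<and> c < 1 \<and> g 0 = x \<and> g b = y \<and> g c = z)"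

definition preserves_cyclic_order :: "(complex \<Rightarrow> complex) \<Rightarrow> complex set \<Rightarrow> bool" where
  "preserves_cyclic_order F \<Gamma> \<longleftrightarrow>
     (\<forall>x\<in>\<Gamma>. \<forall>y\<in>\<Gamma>. \<forall>z\<in>\<Gamma>. cyclic_order \<Gamma> x y z \<longrightarrow> cyclic_order \<Gamma> (F x) (F y) (F z))"

definition R :: "complex \<Rightarrow> complex" where
  "R z = center + \<i> * (z - center)"

definition rotationally_symmetric_circle :: "(complex \<Rightarrow> complex) \<Rightarrow> complex set \<Rightarrow> bool" where
  "rotationally_symmetric_circle F \<Gamma> \<longleftrightarrow>
     invariant_circle F \<Gamma> \<and> center \<in> inside \<Gamma> \<and> preserves_cyclic_order F \<Gamma> \<and> R ` \<Gamma> = \<Gamma>"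

text \<open>The 1-periodic extension \<open>\<lambda>t. g (frac t)\<close> of a closed path \<open>g\<close> is the universal covering of
  its image; \<open>\<Phi>\<close> is a lift of the restriction of \<open>F\<close> through it, of degree one.\<close>

definition circle_lift :: "(complex \<Rightarrow> complex) \<Rightarrow> (real \<Rightarrow> complex) \<Rightarrow> (real \<Rightarrow> real) \<Rightarrow> bool" where
  "circle_lift F g \<Phi> \<longleftrightarrow>
     continuous_on UNIV \<Phi> \<and> (\<forall>t. \<Phi> (t + 1) = \<Phi> t + 1) \<and>
     (\<forall>t. g (frac (\<Phi> t)) = F (g (frac t)))"

text \<open>The limit below depends on the choice of the lift only up to an integer, so its fractional
  part, a number in \<open>[0, 1)\<close>, depends neither on the lift nor on the counterclockwise
  parametrization.\<close>

definition has_rotation_number :: "(complex \<Rightarrow> complex) \<Rightarrow> complex set \<Rightarrow> real \<Rightarrow> bool" where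
  "has_rotation_number F \<Gamma> \<rho> \<longleftrightarrow>
     (\<exists>g \<Phi> \<tau>. ccw_param \<Gamma> g \<and> circle_lift F g \<Phi> \<and>
        (\<forall>x. (\<lambda>n. (\<Phi> ^^ n) x / real n) \<longlonglongrightarrow> \<tau>) \<and> \<rho> = frac \<tau>)"

definition rotation_number :: "(complex \<Rightarrow> complex) \<Rightarrow> complex set \<Rightarrow> real" where
  "rotation_number F \<Gamma> = (THE \<rho>. has_rotation_number F \<Gamma> \<rho>)"

definition annulus_inside_square :: "complex set \<Rightarrow> complex set" where
  "annulus_inside_square \<Gamma> = unit_square - inside \<Gamma>"

text \<open>The annulus between the boundary of the square and \<open>\<Gamma>\<close> is completely foliated by rotationally
  symmetric invariant circles, with rotation numbers continuously and monotonically increasing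
  from \<open>a\<close> to \<open>b\<close>.\<close>

definition completely_foliated ::
    "(complex \<Rightarrow> complex) \<Rightarrow> complex set \<Rightarrow> real \<Rightarrow> real \<Rightarrow> bool" where
  "completely_foliated F \<Gamma> a b \<longleftrightarrow>
     (\<exists>h h'. homeomorphism (sphere (0::complex) 1 \<times> {0..1::real}) (annulus_inside_square \<Gamma>) h h' \<and>
        (let leaf = (\<lambda>r. h ` (sphere 0 1 \<times> {r})) in
           leaf 0 = frontier unit_square \<and> leaf 1 = \<Gamma> \<and>
           (\<forall>r\<in>{0..1}. rotationally_symmetric_circle F (leaf r)) \<and>
           continuous_on {0..1} (\<lambda>r. rotation_number F (leaf r)) \<and>
           mono_on {0..1} (\<lambda>r. rotation_number F (leaf r)) \<and>
           rotation_number F (leaf 0) = a \<and> rotation_number F (leaf 1) = b))"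

definition Gamma0 :: "(complex \<Rightarrow> complex) \<Rightarrow> real \<Rightarrow> nat \<Rightarrow> complex set" where
  "Gamma0 F \<theta> K = (\<Union>i\<in>{0..4 * K - 1}. closed_segment ((F ^^ i) (P \<theta> 4)) ((F ^^ (i + 1)) (P \<theta> 4)))"

end

theory Submission
  imports Defs
begin

text \<open>The leaf with parameter \<open>r\<close> is the convex polygon that follows the orbit
  \<open>r F(P\<^sub>4), \<dots>, r F\<^sup>K(P\<^sub>4) = r P\<^sub>1\<close>, then continues horizontally up to the rotated image of its
  starting point, and is closed up by the rotations \<open>R, R\<^sup>2, R\<^sup>3\<close>. On the cone over \<open>B\<^sub>1\<close> the map is
  linear, and it carries each edge affinely onto the next one; on \<open>A\<^sub>1\<close> it is a horizontal shear, whose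
  step at height \<open>r t\<close> equals \<open>r w\<close> with \<open>w = 1 - 2 s\<close>. If each of the \<open>K\<close> edges is given the length
  \<open>r w\<close>, then \<open>F\<close> is the rotation by \<open>r w\<close> of a circle of length \<open>4 (K r w + 1 - r)\<close>, which yields
  the rotation number. For \<open>r = 1\<close> the horizontal part has become a single edge, for \<open>r = 0\<close> it is a
  whole side of the square.

  The leaves are disjoint and simple because each edge line, at parameter \<open>r\<close>, supports the polygon:
  the functional \<open>z \<mapsto> cross (e k) z\<close> is at least \<open>r w t\<close> on the leaf and equal to it on the edge. A
  point of the square on no leaf has the same winding number with respect to all leaves, namely \<open>1\<close>,
  so that it is inside the innermost one; hence the leaves fill the annulus.\<close>

section \<open>Closed curves with a periodic parametrization\<close>

text \<open>Adjacent closed strips are closed in their union, so \<open>f\<close> is continuous on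
  it; the open double strips are neighbourhoods of all points. This serves for functions with one
  formula per unit interval.\<close>

lemma continuous_on_times_real_if_intervals:
  fixes f :: "'a::t2_space \<times> real \<Rightarrow> 'b::topological_space"
  assumes "\<And>n::int. continuous_on (S \<times> {of_int n..of_int n + 1}) f"
  shows "continuous_on (S \<times> UNIV) f"
proof -
  have loc: "continuous_on (S \<times> {of_int n - 1<..<of_int n + 1}) f" for n :: int
  proof -
    have eq: "S \<times> {of_int n - 1..of_int n + 1} =
        S \<times> {of_int n - 1..of_int n} \<union> S \<times> {of_int n..of_int n + (1::real)}"
      by auto
    have "closedin (top_of_set (S \<times> {of_int n - 1..of_int n + (1::real)})) (S \<times> {of_int n - 1..of_int n})"
      using closedin_closed_Int[of "UNIV \<times> {of_int n - 1..of_int n}" "S \<times> {of_int n - 1..of_int n + (1::real)}"]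
      by (rule back_subst[of "closedin _"]) (auto intro: closed_Times)
    moreover have "closedin (top_of_set (S \<times> {of_int n - 1..of_int n + (1::real)})) (S \<times> {of_int n..of_int n + 1})"
      using closedin_closed_Int[of "UNIV \<times> {of_int n..of_int n + 1}" "S \<times> {of_int n - 1..of_int n + (1::real)}"]
      by (rule back_subst[of "closedin _"]) (auto intro: closed_Times)
    ultimately have "continuous_on (S \<times> {of_int n - 1..of_int n + 1}) f"
      using assms[of n] assms[of "n - 1"] unfolding eq
      by (intro continuous_on_Un_local) auto
    then show ?thesis
      by (rule continuous_on_subset) auto
  qed
  show ?thesis
    unfolding continuous_on_eq_continuous_within
  proof
    fix p assume p: "p \<in> S \<times> (UNIV::real set)"
    define n where "n = \<lfloor>snd p\<rfloor>"
    let ?U = "UNIV \<times> {of_int n - 1<..<of_int n + (1::real)}"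
    have "open ?U" "p \<in> ?U"
      using p by (auto simp: n_def open_Times less_le_trans intro: mem_Times_iff[THEN iffD2]) linarith+
    moreover have "(S \<times> UNIV) \<inter> ?U = S \<times> {of_int n - 1<..<of_int n + (1::real)}"
      by auto
    ultimately have "at p within (S \<times> UNIV) = at p within (S \<times> {of_int n - 1<..<of_int n + (1::real)})"
      by (intro at_within_nhd[of p ?U]) auto
    moreover have "p \<in> S \<times> {of_int n - 1<..<of_int n + (1::real)}"
      using p \<open>p \<in> ?U\<close> by auto
    ultimately show "continuous (at p within (S \<times> UNIV)) f"
      using loc[of n] by (metis continuous_on_eq_continuous_within)
  qed
qed

lemma Ints_periodic:
  assumes "\<And>x::real. f (x + 1) = f x" "x - y \<in> \<int>"
  shows "f x = f y"
proof -
  have nat: "f (x + of_nat n) = f x" for x n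
    by (induction n) (simp_all add: assms(1) flip: add.assoc, metis assms(1) add.assoc add.commute)
  obtain k :: int where k: "x = y + of_int k"
    using assms(2) by (metis Ints_cases add_diff_cancel_left' diff_add_cancel add.commute)
  show ?thesis
  proof (cases "k \<ge> 0")
    case True
    then show ?thesis using nat[of y "nat k"] k by simp
  next
    case False
    then show ?thesis using nat[of x "nat (-k)"] k by simp
  qed
qed

lemma cis_2pi_eq_iff: "cis (2 * pi * x) = cis (2 * pi * y) \<longleftrightarrow> x - y \<in> \<int>"
proof -
  have "cis (2 * pi * x) = cis (2 * pi * y) \<longleftrightarrow> (\<exists>n::int. 2 * pi * x = 2 * pi * y + 2 * pi * of_int n)"
    using sin_cos_eq_iff[of "2 * pi * x" "2 * pi * y"] by (auto simp: complex_eq_iff)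
  also have "\<dots> \<longleftrightarrow> (\<exists>n::int. x - y = of_int n)"
  proof (intro ex_cong1)
    fix n :: int
    have "2 * pi * x = 2 * pi * y + 2 * pi * of_int n \<longleftrightarrow> 2 * pi * (x - y) = 2 * pi * of_int n"
      unfolding right_diff_distrib by linarith
    then show "2 * pi * x = 2 * pi * y + 2 * pi * of_int n \<longleftrightarrow> x - y = of_int n"
      by simp
  qed
  finally show ?thesis
    by (auto simp: Ints_def)
qed

lemma Arg_cis_2pi: "Arg (cis (2 * pi * x)) / (2 * pi) - x \<in> \<int>"
  by (subst cis_2pi_eq_iff[symmetric]) (simp add: cis_Arg sgn_eq)

text \<open>The branch cut of \<open>Arg\<close> is harmless: off the nonnegative reals
  \<open>Arg (- z) / (2 * pi) + 1 / 2\<close> is continuous and differs from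
  \<open>Arg z / (2 * pi)\<close> by an integer, which periodicity absorbs.\<close>

lemma continuous_on_circle_if_periodic:
  fixes H :: "'a::topological_space \<Rightarrow> real \<Rightarrow> 'b::topological_space"
  assumes cont: "continuous_on (S \<times> UNIV) (\<lambda>(r, x). H r x)"
    and per: "\<And>r x. r \<in> S \<Longrightarrow> H r (x + 1) = H r x"
  shows "continuous_on (sphere 0 1 \<times> S) (\<lambda>(z, r). H r (Arg z / (2 * pi)))"
proof -
  let ?C = "sphere (0::complex) 1 \<times> S"
  let ?U = "?C \<inter> (- \<real>\<^sub>\<le>\<^sub>0) \<times> UNIV" and ?V = "?C \<inter> (- \<real>\<^sub>\<ge>\<^sub>0) \<times> UNIV"
  have op: "openin (top_of_set ?C) ?U" "openin (top_of_set ?C) ?V"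
    by (intro openin_open_Int open_Times; simp add: open_Compl)+
  have cov: "?C = ?U \<union> ?V"
    by (auto simp: complex_nonneg_Reals_iff complex_nonpos_Reals_iff complex_eq_iff)
      (metis norm_zero complex_eqI one_neq_zero order_antisym zero_complex.simps)+
  have cU: "continuous_on ?U (\<lambda>(z, r). H r (Arg z / (2 * pi)))"
    unfolding case_prod_unfold
    by (rule continuous_on_compose2[OF cont, of _ "\<lambda>p. (snd p, Arg (fst p) / (2 * pi))", unfolded case_prod_unfold, simplified])
      (auto intro!: continuous_intros)
  have "continuous_on ?V (\<lambda>(z, r). H r (Arg (- z) / (2 * pi) + 1 / 2))"
    unfolding case_prod_unfold
    by (rule continuous_on_compose2[OF cont, of _ "\<lambda>p. (snd p, Arg (- fst p) / (2 * pi) + 1 / 2)", unfolded case_prod_unfold, simplified])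
      (auto intro!: continuous_intros simp: complex_nonneg_Reals_iff complex_nonpos_Reals_iff)
  moreover have "H r (Arg (- z) / (2 * pi) + 1 / 2) = H r (Arg z / (2 * pi))" if "(z, r) \<in> ?V" for z r
  proof (rule Ints_periodic)
    have "z \<noteq> 0" using that by auto
    then show "Arg (- z) / (2 * pi) + 1 / 2 - Arg z / (2 * pi) \<in> \<int>"
      by (auto simp: Arg_minus add_divide_distrib diff_divide_distrib)
  qed (use that per in auto)
  ultimately have cV: "continuous_on ?V (\<lambda>(z, r). H r (Arg z / (2 * pi)))"
    by (subst continuous_on_cong[OF refl, where g = "\<lambda>(z, r). H r (Arg (- z) / (2 * pi) + 1 / 2)"]) auto
  show ?thesis
    using continuous_on_Un_local_open[of ?U ?V] op cU cV cov by simp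
qed

text \<open>By \<open>eq\<close>, \<open>h\<close> is injective on a compact domain, hence a
  homeomorphism onto its image. A general \<open>S\<close> covers both the foliation and, as a
  one-point set, a single curve.\<close>

lemma circle_family_homeomorphism:
  fixes H :: "'a::t2_space \<Rightarrow> real \<Rightarrow> 'b::t2_space"
  assumes cont: "continuous_on (S \<times> UNIV) (\<lambda>(r, x). H r x)"
    and S: "compact S"
    and eq: "\<And>r r' x x'. r \<in> S \<Longrightarrow> r' \<in> S \<Longrightarrow> H r x = H r' x' \<longleftrightarrow> r = r' \<and> x - x' \<in> \<int>"
  defines "h \<equiv> \<lambda>(z::complex, r). H r (Arg z / (2 * pi))"
  obtains k where "homeomorphism (sphere 0 1 \<times> S) (\<Union>r\<in>S. range (H r)) h k"
    "\<And>r x. r \<in> S \<Longrightarrow> h (cis (2 * pi * x), r) = H r x"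
    "\<And>r. r \<in> S \<Longrightarrow> h ` (sphere 0 1 \<times> {r}) = range (H r)"
proof -
  have hcis: "h (cis (2 * pi * x), r) = H r x" if "r \<in> S" for x r
    unfolding h_def using that eq Arg_cis_2pi by simp
  have img: "h ` (sphere 0 1 \<times> {r}) = range (H r)" if "r \<in> S" for r
  proof
    show "h ` (sphere 0 1 \<times> {r}) \<subseteq> range (H r)" by (auto simp: h_def)
    show "range (H r) \<subseteq> h ` (sphere 0 1 \<times> {r})"
      using hcis[OF that] by (auto intro!: image_eqI[where x = "(cis (2 * pi * x), r)" for x])
  qed
  have "continuous_on (sphere 0 1 \<times> S) h"
    unfolding h_def using eq by (intro continuous_on_circle_if_periodic cont) auto
  moreover have "h ` (sphere 0 1 \<times> S) = (\<Union>r\<in>S. range (H r))"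
  proof -
    have "h ` (sphere 0 1 \<times> S) = (\<Union>r\<in>S. h ` (sphere 0 1 \<times> {r}))" by auto
    then show ?thesis using img by simp
  qed
  moreover have "inj_on h (sphere 0 1 \<times> S)"
  proof (rule inj_onI, clarify)
    fix z z' :: complex and r r'
    assume z: "z \<in> sphere 0 1" "z' \<in> sphere 0 1" and r: "r \<in> S" "r' \<in> S" and "h (z, r) = h (z', r')"
    then have *: "r = r'" "Arg z / (2 * pi) - Arg z' / (2 * pi) \<in> \<int>"
      by (simp_all add: h_def eq)
    then have "cis (Arg z) = cis (Arg z')"
      using cis_2pi_eq_iff[of "Arg z / (2 * pi)" "Arg z' / (2 * pi)"] by simp
    then show "z = z' \<and> r = r'"
      using z * by (metis cis_Arg mem_sphere_0 norm_zero sgn_eq div_by_1 of_real_1 zero_neq_one)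
  qed
  ultimately obtain k where "homeomorphism (sphere 0 1 \<times> S) (\<Union>r\<in>S. range (H r)) h k"
    using homeomorphism_compact[of "sphere 0 1 \<times> S" h] S compact_Times compact_sphere by metis
  then show ?thesis using that hcis img by blast
qed

lemma int_valued_continuous_constant:
  fixes f :: "real \<Rightarrow> real"
  assumes "continuous_on UNIV f" "\<And>x. f x \<in> \<int>"
  obtains n :: int where "\<And>x. f x = of_int n"
proof -
  have "f constant_on UNIV"
  proof (rule continuous_discrete_range_constant)
    fix x :: real
    have "norm (f y - f x) \<ge> 1" if "f y \<noteq> f x" for y
      using Ints_nonzero_abs_ge1[of "f y - f x"] that assms(2) by (auto intro: Ints_diff)
    then show "\<exists>e>0. \<forall>y. y \<in> UNIV \<and> f y \<noteq> f x \<longrightarrow> e \<le> norm (f y - f x)"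
      by (intro exI[of _ 1]) auto
  qed (use assms in auto)
  then obtain c where c: "\<And>x. f x = c"
    by (auto simp: constant_on_def)
  moreover obtain n where "c = of_int n"
    using assms(2)[of 0] c Ints_cases by metis
  ultimately show ?thesis using that by auto
qed

section \<open>Jordan curves as periodic maps of the line\<close>

text \<open>Only the restriction of \<open>G\<close> to the unit interval enters
  \<open>winding_number\<close>. Working on the whole line makes a rotation of the curve a
  translation of the parameter.\<close>

locale jordan_param =
  fixes G :: "real \<Rightarrow> complex" and z0 :: complex
  assumes cont: "continuous_on UNIV G"
    and eq_iff: "\<And>x y. G x = G y \<longleftrightarrow> x - y \<in> \<int>"
    and z0: "z0 \<notin> range G"
    and wn: "winding_number G z0 = 1"
begin

lemma param_periodic [simp]: "G (x + 1) = G x"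
  by (simp add: eq_iff)

lemma param_frac [simp]: "G (frac x) = G x"
  by (simp add: eq_iff frac_def)

lemma range_shift: "(\<lambda>x. G (a + x)) ` {0..1} = range G"
proof
  show "range G \<subseteq> (\<lambda>x. G (a + x)) ` {0..1}"
  proof clarify
    fix x
    have "G x = G (a + frac (x - a))"
      by (simp add: eq_iff frac_def)
    moreover have "frac (x - a) \<in> {0..1}"
      using frac_lt_1[of "x - a"] frac_ge_0[of "x - a"] by simp
    ultimately show "G x \<in> (\<lambda>x. G (a + x)) ` {0..1}"
      by (rule image_eqI)
  qed
qed auto

lemma path_shift:
  shows "path (\<lambda>x. G (a + x))" and "pathstart (\<lambda>x. G (a + x)) = G a"
    and "pathfinish (\<lambda>x. G (a + x)) = G a"
    and "path_image (\<lambda>x. G (a + x)) = range G"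
proof -
  show "path (\<lambda>x. G (a + x))"
    unfolding path_def by (intro continuous_on_compose2[OF cont]) (auto intro!: continuous_intros)
qed (auto simp: pathstart_def pathfinish_def path_image_def range_shift)

lemma simple_path_shift: "simple_path (\<lambda>x. G (a + x))"
proof -
  have "x = y \<or> x = 0 \<and> y = 1 \<or> x = 1 \<and> y = 0"
    if "x \<in> {0..1}" "y \<in> {0..1}" "x - y \<in> \<int>" for x y :: real
  proof -
    obtain n :: int where n: "x - y = of_int n"
      using \<open>x - y \<in> \<int>\<close> Ints_cases by blast
    then have "\<bar>of_int n :: real\<bar> \<le> 1"
      using that by auto
    then have "n = 0 \<or> n = 1 \<or> n = -1"
      by linarith
    then show ?thesis using n that by auto
  qed
  then show ?thesis
    unfolding simple_path_def loop_free_def using path_shift(1)[of a] by (auto simp: eq_iff)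
qed

text \<open>The base point slides from parameter \<open>0\<close> to \<open>a\<close> along the
  curve itself, which avoids \<open>z0\<close>; this is a homotopy of loops.\<close>

lemma winding_number_shift: "winding_number (\<lambda>x. G (a + x)) z0 = 1"
proof -
  have "homotopic_loops (- {z0}) (\<lambda>x. G (0 + x)) (\<lambda>x. G (a + x))"
    unfolding homotopic_loops
  proof (intro exI[of _ "\<lambda>(u, x). G (u * a + x)"] conjI ballI)
    show "continuous_on ({0..1} \<times> {0..1}) (\<lambda>(u, x). G (u * a + x))"
      unfolding case_prod_unfold
      by (intro continuous_on_compose2[OF cont]) (auto intro!: continuous_intros)
  qed (use z0 in \<open>auto simp: pathstart_def pathfinish_def\<close>)
  then show ?thesis
    using winding_number_homotopic_loops wn by force
qed

lemma z0_inside: "z0 \<in> inside (range G)"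
proof (rule ccontr)
  assume "z0 \<notin> inside (range G)"
  then have "z0 \<in> outside (path_image (\<lambda>x. G (0 + x)))"
    using z0 by (metis path_shift(4) inside_Un_outside Compl_iff UnE)
  then have "winding_number (\<lambda>x. G (0 + x)) z0 = 0"
    by (intro winding_number_zero_in_outside path_shift) (simp add: path_shift del: add_0)
  then show False
    using wn by simp
qed

lemma ccw_param_shift: "ccw_param (range G) (\<lambda>x. G (a + x))"
  unfolding ccw_param_def
proof (intro conjI ballI simple_path_shift)
  fix z assume "z \<in> inside (range G)"
  \<comment> \<open>Inside a simple closed curve the winding number is constantly \<open>1\<close>
    or constantly \<open>-1\<close>; its value at \<open>z0\<close> fixes the sign.\<close>
  then show "winding_number (\<lambda>x. G (a + x)) z = 1"
    using simple_closed_path_winding_number_inside[OF simple_path_shift[of a]]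
      winding_number_shift[of a] z0_inside
    by (metis path_shift(4) one_neq_neg_one)
qed (simp_all add: path_shift)

lemma simple_closed_curve_range: "simple_closed_curve (range G)"
  using ccw_param_shift[of 0] unfolding ccw_param_def simple_closed_curve_def by blast

text \<open>A continuous logarithm of \<open>G - z0\<close> increases by \<open>2\<pi>\<i>\<close> over each period, because the winding
  number is \<open>1\<close>; so the winding number of \<open>G \<circ> \<phi>\<close> is the increment of \<open>\<phi>\<close>.\<close>
lemma winding_number_comp:
  assumes \<phi>: "continuous_on {0..1} \<phi>" and d: "\<phi> 1 = \<phi> 0 + of_int d"
  shows "winding_number (\<lambda>x. G (\<phi> x)) z0 = of_int d"
proof -
  have "continuous_on UNIV (\<lambda>x. G x - z0)"
    by (intro continuous_intros cont)
  then obtain Q where Q: "continuous_on UNIV Q" and exp_Q: "\<And>x. G x - z0 = exp (Q x)"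
    using continuous_logarithm_on_contractible[of UNIV "\<lambda>x. G x - z0"] z0 contractible_UNIV
    by (metis UNIV_I eq_iff_diff_eq_0 rangeI)
  have wnQ: "winding_number (\<lambda>x. G (\<psi> x)) z0 = (Q (\<psi> 1) - Q (\<psi> 0)) / (2 * of_real pi * \<i>)"
    if "continuous_on {0..1} \<psi>" for \<psi>
  proof -
    have "path (Q \<circ> \<psi>)"
      unfolding path_def by (intro continuous_on_compose that continuous_on_subset[OF Q]) auto
    from winding_number_compose_exp[OF this] show ?thesis
      by (subst winding_number_offset) (simp add: exp_Q o_def pathfinish_def pathstart_def)
  qed
  have Im_Q: "\<exists>n::int. Q (x + 1) = Q x + of_int (2 * n) * pi * \<i>" for x
    using exp_Q[of x] exp_Q[of "x + 1"] by (metis param_periodic exp_eq)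
  \<comment> \<open>The increment of \<open>Q\<close> over a period in units of
    \<open>2 * pi * \<i>\<close>: continuous and integer valued, hence constant.\<close>
  define I where "I x = Im (Q (x + 1) - Q x) / (2 * pi)" for x
  have Q_I: "Q (x + 1) = Q x + 2 * pi * \<i> * I x" and I_Ints: "I x \<in> \<int>" for x
  proof -
    obtain n :: int where "Q (x + 1) = Q x + of_int (2 * n) * pi * \<i>" using Im_Q by blast
    then show "Q (x + 1) = Q x + 2 * pi * \<i> * I x" "I x \<in> \<int>"
      by (auto simp: I_def)
  qed
  have "continuous_on UNIV I"
    unfolding I_def by (auto intro!: continuous_intros continuous_on_compose2[OF Q])
  then obtain n :: int where n: "\<And>x. I x = of_int n"
    using int_valued_continuous_constant I_Ints by blast
  have "n = 1"
    using wnQ[of "\<lambda>x. x"] wn Q_I[of 0] by (simp add: n continuous_on_id)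
  \<comment> \<open>After subtraction of a linear part \<open>Q\<close> is periodic, so its
    increment along \<open>\<phi>\<close> is that of the linear part.\<close>
  then have "Q (x + 1) - 2 * pi * \<i> * (x + 1) = Q x - 2 * pi * \<i> * x" for x
    using Q_I[of x] n by (simp add: algebra_simps)
  then have "Q (\<phi> 1) - 2 * pi * \<i> * \<phi> 1 = Q (\<phi> 0) - 2 * pi * \<i> * \<phi> 0"
    using Ints_periodic[of "\<lambda>x. Q x - 2 * pi * \<i> * x" "\<phi> 1" "\<phi> 0"] d by simp
  then have "Q (\<phi> 1) - Q (\<phi> 0) = 2 * pi * \<i> * of_int d"
    by (simp add: d algebra_simps)
  then show ?thesis
    using wnQ[OF \<phi>] by simp
qed

text \<open>Cyclic order and rotation number admit every counterclockwise parametrization; this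
  reduces them to \<open>G\<close>. Transport to the unit circle and a continuous logarithm give
  \<open>\<phi>\<close>, the winding number gives its increment, and simplicity of \<open>g\<close>
  its monotonicity.\<close>

lemma ccw_param_reparametrization:
  assumes g: "ccw_param (range G) g"
  obtains \<phi> where "continuous_on {0..1} \<phi>" "strict_mono_on {0..1} \<phi>" "\<phi> 1 = \<phi> 0 + 1"
    "\<And>x. x \<in> {0..1} \<Longrightarrow> g x = G (\<phi> x)"
proof -
  have g': "simple_path g" "g 1 = g 0" "g ` {0..1} = range G"
    and wn_g: "winding_number g z0 = 1"
    using g z0_inside by (auto simp: ccw_param_def pathfinish_def pathstart_def path_image_def)
  have cont_g: "continuous_on {0..1} g"
    using g'(1) simple_path_imp_path path_def by blast
  let ?H = "\<lambda>r::real. G"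
  have contH: "continuous_on ({0} \<times> UNIV) (\<lambda>(r, x). ?H r x)"
    unfolding case_prod_unfold by (intro continuous_on_compose2[OF cont]) (auto intro!: continuous_intros)
  obtain h k where hk: "homeomorphism (sphere 0 1 \<times> {0::real}) (range G) h k"
    and h: "\<And>x. h (cis (2 * pi * x), 0) = G x"
    by (rule circle_family_homeomorphism[OF contH]) (auto simp: eq_iff)
  define p where "p = fst \<circ> (k \<circ> g)"
  have "g ` {0..1} \<subseteq> range G" using g' by simp
  then have "path p"
    unfolding p_def path_def using homeomorphism_cont2[OF hk] cont_g
    by (intro continuous_on_compose continuous_intros) (auto intro: continuous_on_subset)
  moreover have kg: "k (g x) \<in> sphere 0 1 \<times> {0}" if "x \<in> {0..1}" for x
    using homeomorphism_image2[OF hk] g'(3) that by blast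
  then have norm_p: "norm (p x) = 1" if "x \<in> {0..1}" for x
    using that unfolding p_def by (metis comp_apply mem_sphere_0 mem_Times_iff)
  then have "0 \<notin> path_image p"
    by (fastforce simp: path_image_def)
  ultimately obtain q where q: "path q" "\<And>x. x \<in> {0..1} \<Longrightarrow> p x = 0 + exp (q x)"
    using winding_number_as_continuous_log by metis
  define \<phi> where "\<phi> x = Im (q x) / (2 * pi)" for x
  have cont_\<phi>: "continuous_on {0..1} \<phi>"
    unfolding \<phi>_def using q(1) by (auto simp: path_def intro!: continuous_intros)
  have g_\<phi>: "g x = G (\<phi> x)" if x: "x \<in> {0..1}" for x
  proof -
    have "p x = cis (2 * pi * \<phi> x)"
      using q(2)[OF x] norm_p[OF x] by (simp add: \<phi>_def exp_eq_polar norm_mult)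
    then have "k (g x) = (cis (2 * pi * \<phi> x), 0)"
      using kg[OF x] by (auto simp: p_def prod_eq_iff mem_Times_iff)
    then show ?thesis
      using h homeomorphism_apply2[OF hk, of "g x"] g'(3) x by (metis imageI)
  qed
  have "\<phi> 1 - \<phi> 0 \<in> \<int>"
    using g'(2) g_\<phi>[of 0] g_\<phi>[of 1] by (simp add: eq_iff)
  then obtain d :: int where d: "\<phi> 1 = \<phi> 0 + of_int d"
    by (metis Ints_cases add_diff_cancel_left' add_diff_eq)
  have "winding_number g z0 = winding_number (\<lambda>x. G (\<phi> x)) z0"
    by (rule winding_number_cong) (auto simp: g_\<phi>)
  then have "d = 1"
    using winding_number_comp[OF cont_\<phi> d] wn_g by simp
  \<comment> \<open>\<open>g\<close> repeats a value only at \<open>0\<close> and \<open>1\<close>,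
    where the values of \<open>\<phi>\<close> differ by \<open>1\<close>.\<close>
  have "inj_on \<phi> {0..1}"
  proof (rule inj_onI)
    fix x y :: real assume xy: "x \<in> {0..1}" "y \<in> {0..1}" "\<phi> x = \<phi> y"
    then have "g x = g y" using g_\<phi> by simp
    then show "x = y"
      using g'(1) xy d \<open>d = 1\<close> unfolding simple_path_def loop_free_def by fastforce
  qed
  then have "strict_mono_on {0..1} \<phi> \<or> strict_antimono_on {0..1} \<phi>"
    using injective_eq_monotone_map[OF _ cont_\<phi>] by (simp add: is_interval_cc)
  moreover have "\<not> strict_antimono_on {0..1} \<phi>"
    using d \<open>d = 1\<close> monotone_onD[of "{0..1}" "(<)" "(>)" \<phi> 0 1] by auto
  ultimately show ?thesis
    using that cont_\<phi> d \<open>d = 1\<close> g_\<phi> by simp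
qed

text \<open>On the line \<open>F\<close> is a translation, so the parameters of the three points
  keep their order within one period; the shift of \<open>G\<close> that starts at
  \<open>F x\<close> displays it.\<close>

lemma preserves_cyclic_order_range:
  assumes F: "\<And>x. F (G x) = G (x + \<rho>)"
  shows "preserves_cyclic_order F (range G)"
  unfolding preserves_cyclic_order_def
proof (intro ballI impI)
  fix x y z assume "cyclic_order (range G) x y z"
  then obtain g b c where g: "ccw_param (range G) g" "0 < b" "b < c" "c < 1"
    and xyz: "g 0 = x" "g b = y" "g c = z"
    unfolding cyclic_order_def by blast
  obtain \<phi> where \<phi>: "strict_mono_on {0..1} \<phi>" "\<phi> 1 = \<phi> 0 + 1"
    and g\<phi>: "\<And>x. x \<in> {0..1} \<Longrightarrow> g x = G (\<phi> x)"
    using ccw_param_reparametrization[OF g(1)] by blast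
  have "\<phi> 0 < \<phi> b" "\<phi> b < \<phi> c" "\<phi> c < \<phi> 1"
    using g by (auto intro!: strict_mono_onD[OF \<phi>(1)])
  moreover have "F x = G (\<phi> 0 + \<rho> + 0)" "F y = G (\<phi> 0 + \<rho> + (\<phi> b - \<phi> 0))"
    "F z = G (\<phi> 0 + \<rho> + (\<phi> c - \<phi> 0))"
    using g\<phi>[of 0] g\<phi>[of b] g\<phi>[of c] g F by (auto simp: algebra_simps simp flip: xyz)
  ultimately show "cyclic_order (range G) (F x) (F y) (F z)"
    unfolding cyclic_order_def using ccw_param_shift[of "\<phi> 0 + \<rho>"] \<phi>(2)
    by (intro exI[of _ "\<lambda>x. G (\<phi> 0 + \<rho> + x)"] exI[of _ "\<phi> b - \<phi> 0"] exI[of _ "\<phi> c - \<phi> 0"]) auto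
qed

text \<open>Extended to the line as \<open>\<psi>\<close>, the reparametrization turns any lift into
  a translation by \<open>\<rho>\<close> plus an integer. As \<open>\<psi>\<close> stays within
  bounded distance of the identity, both have the same mean displacement.\<close>

lemma has_rotation_number_unique:
  assumes F: "\<And>x. F (G x) = G (x + \<rho>)" and "has_rotation_number F (range G) \<rho>'"
  shows "\<rho>' = frac \<rho>"
proof -
  obtain g \<Phi> \<tau> where g: "ccw_param (range G) g" and \<Phi>: "circle_lift F g \<Phi>"
    and lim: "(\<lambda>n. (\<Phi> ^^ n) 0 / real n) \<longlonglongrightarrow> \<tau>" and \<rho>': "\<rho>' = frac \<tau>"
    using assms(2) unfolding has_rotation_number_def by blast
  obtain \<phi> where \<phi>: "continuous_on {0..1} \<phi>" "strict_mono_on {0..1} \<phi>" "\<phi> 1 = \<phi> 0 + 1"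
    and g\<phi>: "\<And>x. x \<in> {0..1} \<Longrightarrow> g x = G (\<phi> x)"
    using ccw_param_reparametrization[OF g] by blast
  define \<psi> where "\<psi> x = \<phi> (frac x) + of_int \<lfloor>x\<rfloor>" for x
  have g\<psi>: "g (frac x) = G (\<psi> x)" for x
    using g\<phi>[of "frac x"] frac_lt_1[of x] by (simp add: \<psi>_def eq_iff less_imp_le)
  have "continuous_on {of_int n..of_int n + 1} \<psi>" for n :: int
  proof -
    have "\<psi> x = \<phi> (x - of_int n) + of_int n" if "x \<in> {of_int n..of_int n + 1}" for x
    proof (cases "x = of_int n + 1")
      \<comment> \<open>At the right endpoint \<open>frac\<close> drops to \<open>0\<close> while
        the floor rises by one; \<open>\<phi> 1 = \<phi> 0 + 1\<close> compensates.\<close>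
      case True
      then show ?thesis using \<phi>(3) by (simp add: \<psi>_def)
    next
      case False
      then have "\<lfloor>x\<rfloor> = n" using that by (auto simp: floor_eq_iff)
      then show ?thesis by (simp add: \<psi>_def frac_def)
    qed
    moreover have "continuous_on {of_int n..of_int n + 1} (\<lambda>x. \<phi> (x - of_int n) + of_int n)"
      by (intro continuous_intros continuous_on_compose2[OF \<phi>(1)]) auto
    ultimately show ?thesis
      using continuous_on_cong by (metis (no_types, lifting))
  qed
  \<comment> \<open>The factor \<open>{0}\<close> brings \<open>\<psi>\<close> into the product form
    of the gluing lemma.\<close>
  then have "continuous_on ({0::real} \<times> {of_int n..of_int n + 1}) (\<psi> \<circ> snd)" for n :: int
    by (intro continuous_on_compose continuous_intros) auto
  then have "continuous_on ({0::real} \<times> UNIV) (\<psi> \<circ> snd)"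
    by (rule continuous_on_times_real_if_intervals)
  from continuous_on_compose2[OF this, of UNIV "\<lambda>x. (0, x)"]
  have cont_\<psi>: "continuous_on UNIV \<psi>"
    by (simp add: o_def image_subset_iff continuous_on_Pair)
  have cont_\<Phi>: "continuous_on UNIV \<Phi>" and lift: "\<And>x. g (frac (\<Phi> x)) = F (g (frac x))"
    using \<Phi> by (auto simp: circle_lift_def)
  have "\<psi> (\<Phi> x) - \<psi> x - \<rho> \<in> \<int>" for x
    using lift[of x] F by (simp add: g\<psi> eq_iff algebra_simps)
  moreover have "continuous_on UNIV (\<lambda>x. \<psi> (\<Phi> x) - \<psi> x - \<rho>)"
    by (intro continuous_intros cont_\<psi> continuous_on_compose2[OF cont_\<psi>] cont_\<Phi>) auto
  ultimately obtain n :: int where n: "\<And>x. \<psi> (\<Phi> x) - \<psi> x - \<rho> = of_int n"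
    using int_valued_continuous_constant[of "\<lambda>x. \<psi> (\<Phi> x) - \<psi> x - \<rho>"] by blast
  then have step: "\<psi> (\<Phi> x) = \<psi> x + (\<rho> + of_int n)" for x
    by (simp add: algebra_simps)
  have iter: "\<psi> ((\<Phi> ^^ m) 0) = \<psi> 0 + real m * (\<rho> + of_int n)" for m
    by (induction m) (simp_all add: step algebra_simps)
  obtain B where B: "\<And>x. \<bar>\<psi> x - x\<bar> \<le> B"
  proof -
    have "bounded (\<phi> ` {0..1})"
      by (intro compact_imp_bounded compact_continuous_image \<phi>) simp
    then obtain b where b: "\<And>x. x \<in> {0..1} \<Longrightarrow> \<bar>\<phi> x\<bar> \<le> b"
      unfolding bounded_iff by (metis imageI real_norm_def)
    have "\<bar>\<psi> x - x\<bar> \<le> b + 1" for x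
    proof -
      have "\<psi> x - x = \<phi> (frac x) - frac x" by (simp add: \<psi>_def frac_def)
      moreover have "frac x \<in> {0..1}" using frac_lt_1[of x] by (simp add: less_imp_le)
      ultimately show ?thesis using b[of "frac x"] frac_ge_0[of x] frac_lt_1[of x] by linarith
    qed
    then show ?thesis using that by blast
  qed
  have "(\<lambda>m. (\<Phi> ^^ m) 0 / real m - (\<rho> + of_int n)) \<longlonglongrightarrow> 0"
  proof (rule Lim_null_comparison)
    show "\<forall>\<^sub>F m in sequentially. norm ((\<Phi> ^^ m) 0 / real m - (\<rho> + of_int n)) \<le> (B + \<bar>\<psi> 0\<bar>) * (1 / real m)"
      using eventually_gt_at_top[of 0]
    proof eventually_elim
      case (elim m)
      have "\<bar>(\<Phi> ^^ m) 0 - real m * (\<rho> + of_int n)\<bar> \<le> B + \<bar>\<psi> 0\<bar>"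
        using B[of "(\<Phi> ^^ m) 0"] iter[of m] by linarith
      moreover have "(\<Phi> ^^ m) 0 / real m - (\<rho> + of_int n) = ((\<Phi> ^^ m) 0 - real m * (\<rho> + of_int n)) / real m"
        using elim by (simp add: diff_divide_distrib)
      ultimately show ?case
        using elim by (simp add: abs_divide divide_right_mono)
    qed
    show "(\<lambda>m. (B + \<bar>\<psi> 0\<bar>) * (1 / real m)) \<longlonglongrightarrow> 0"
      by (rule tendsto_mult_right_zero) (rule lim_1_over_n)
  qed
  then have "(\<lambda>m. (\<Phi> ^^ m) 0 / real m) \<longlonglongrightarrow> \<rho> + of_int n"
    by (simp add: LIM_zero_iff)
  then have "\<tau> = \<rho> + of_int n"
    using lim LIMSEQ_unique by blast
  then show ?thesis
    using \<rho>' by simp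
qed

lemma rotation_number_range:
  assumes F: "\<And>x. F (G x) = G (x + \<rho>)"
  shows "rotation_number F (range G) = frac \<rho>"
  unfolding rotation_number_def
proof (rule the_equality)
  have iter: "((\<lambda>t. t + \<rho>) ^^ n) x = x + real n * \<rho>" for n x
    by (induction n) (simp_all add: algebra_simps)
  have "(\<lambda>n. ((\<lambda>t. t + \<rho>) ^^ n) x / real n) \<longlonglongrightarrow> \<rho>" for x
  proof -
    have "(\<lambda>n. x * (1 / real n) + \<rho>) \<longlonglongrightarrow> 0 + \<rho>"
      by (intro tendsto_intros tendsto_mult_right_zero lim_1_over_n)
    moreover have "\<forall>\<^sub>F n in sequentially. x * (1 / real n) + \<rho> = ((\<lambda>t. t + \<rho>) ^^ n) x / real n"
      using eventually_gt_at_top[of 0] by eventually_elim (simp add: iter add_divide_distrib)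
    ultimately show ?thesis
      by (simp add: Lim_transform_eventually)
  qed
  moreover have "circle_lift F G (\<lambda>t. t + \<rho>)"
    by (auto simp: circle_lift_def F intro!: continuous_intros)
  ultimately show "has_rotation_number F (range G) (frac \<rho>)"
    unfolding has_rotation_number_def using ccw_param_shift[of 0] by (auto cong: conj_cong)
qed (use has_rotation_number_unique[OF F] in blast)

end

section \<open>Families of symmetric leaves\<close>

text \<open>The interface between the topology and the explicit polygons. \<open>eq_iff\<close>
  contains both that each leaf is a Jordan curve and that distinct leaves are disjoint.\<close>

locale symmetric_leaves =
  fixes F :: "complex \<Rightarrow> complex" and G :: "real \<Rightarrow> real \<Rightarrow> complex" and \<rho> :: "real \<Rightarrow> real"
  assumes cont: "continuous_on ({0..1} \<times> UNIV) (\<lambda>(r, x). G r x)"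
    and eq_iff: "\<And>r r' x x'. r \<in> {0..1} \<Longrightarrow> r' \<in> {0..1} \<Longrightarrow> G r x = G r' x' \<longleftrightarrow> r = r' \<and> x - x' \<in> \<int>"
    and outer: "range (G 0) = frontier unit_square"
    and winding_number_outer: "\<And>z. z \<in> interior unit_square \<Longrightarrow> winding_number (G 0) z = 1"
    and in_square: "\<And>r. r \<in> {0..1} \<Longrightarrow> range (G r) \<subseteq> unit_square"
    and inner: "range (G 1) \<subseteq> interior unit_square"
    and center: "\<And>r. r \<in> {0..1} \<Longrightarrow> center \<notin> range (G r)"
    and F: "\<And>r x. r \<in> {0..1} \<Longrightarrow> F (G r x) = G r (x + \<rho> r)"
    and R: "\<And>r x. r \<in> {0..1} \<Longrightarrow> R (G r x) = G r (x + 1 / 4)"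
begin

lemma continuous_on_leaf_comp:
  assumes "continuous_on S a" "continuous_on S b" "\<And>p. p \<in> S \<Longrightarrow> a p \<in> {0..1}"
  shows "continuous_on S (\<lambda>p. G (a p) (b p))"
  using continuous_on_compose2[OF cont continuous_on_Pair[OF assms(1,2)]] assms(3)
  by (simp add: image_subset_iff)

lemma cont_leaf: "r \<in> {0..1} \<Longrightarrow> continuous_on UNIV (G r)"
  by (intro continuous_on_leaf_comp continuous_intros)

lemma range_translate: "range (\<lambda>x. G r (x + a)) = range (G r)"
proof -
  have "G r x \<in> range (\<lambda>x. G r (x + a))" for x
    by (rule image_eqI[of _ _ "x - a"]) auto
  then show ?thesis by auto
qed

text \<open>The leaves with parameters from \<open>0\<close> to \<open>r\<close> form a homotopy of
  loops that never meets \<open>z\<close>, and for the boundary leaf the winding number is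
  known.\<close>

lemma winding_number_leaf:
  assumes z: "z \<in> interior unit_square" "\<And>r. r \<in> {0..1} \<Longrightarrow> z \<notin> range (G r)" and r: "r \<in> {0..1}"
  shows "winding_number (G r) z = 1"
proof -
  have u: "u * r \<in> {0..1}" if "u \<in> {0..1}" for u
    using that r mult_le_one[of u r] by auto
  have "homotopic_loops (- {z}) (G 0) (G r)"
    unfolding homotopic_loops
  proof (intro exI[of _ "\<lambda>(u, x). G (u * r) x"] conjI ballI)
    show "continuous_on ({0..1} \<times> {0..1}) (\<lambda>(u, x). G (u * r) x)"
      unfolding case_prod_unfold using u
      by (intro continuous_on_leaf_comp continuous_intros) auto
    show "(\<lambda>(u, x). G (u * r) x) \<in> {0..1} \<times> {0..1} \<rightarrow> - {z}"
      using u z(2) by clarsimp (metis atLeastAtMost_iff rangeI)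
  qed (use u in \<open>auto simp: pathstart_def pathfinish_def eq_iff\<close>)
  then show ?thesis
    using winding_number_homotopic_loops winding_number_outer[OF z(1)] by metis
qed

lemma center_interior: "center \<in> interior unit_square"
  by (simp add: center_def unit_square_def in_box_complex_iff)

lemma jordan_param_leaf: "r \<in> {0..1} \<Longrightarrow> jordan_param (G r) center"
  using cont_leaf center winding_number_leaf[OF center_interior] eq_iff[of r r]
  by unfold_locales auto

lemma rotation_number_leaf: "r \<in> {0..1} \<Longrightarrow> rotation_number F (range (G r)) = frac (\<rho> r)"
  by (rule jordan_param.rotation_number_range[OF jordan_param_leaf F])

lemma rotationally_symmetric_leaf:
  assumes r: "r \<in> {0..1}"
  shows "rotationally_symmetric_circle F (range (G r))"
proof -
  interpret jordan_param "G r" center by (rule jordan_param_leaf[OF r])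
  have "F ` range (G r) = range (G r)" "R ` range (G r) = range (G r)"
    using F[OF r] R[OF r] range_translate by (simp_all add: image_image)
  then show ?thesis
    unfolding rotationally_symmetric_circle_def invariant_circle_def
    using simple_closed_curve_range in_square[OF r] z0_inside preserves_cyclic_order_range F[OF r]
    by blast
qed

lemma annulus_eq: "annulus_inside_square (range (G 1)) = (\<Union>r\<in>{0..1}. range (G r))"
proof (intro equalityI subsetI)
  interpret jordan_param "G 1" center by (rule jordan_param_leaf) simp
  fix z assume z: "z \<in> annulus_inside_square (range (G 1))"
  show "z \<in> (\<Union>r\<in>{0..1}. range (G r))"
  proof (rule ccontr)
    assume not_leaf: "z \<notin> (\<Union>r\<in>{0..1}. range (G r))"
    \<comment> \<open>Being off the boundary leaf, \<open>z\<close> is interior to the square;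
      winding number \<open>1\<close> then excludes the outside of the innermost leaf.\<close>
    have "z \<in> unit_square" "z \<notin> range (G 0)" "z \<notin> range (G 1)"
      using z not_leaf by (auto simp: annulus_inside_square_def)
    then have "z \<in> interior unit_square"
      unfolding outer frontier_def using closure_subset by auto
    then have "winding_number (G 1) z = 1"
      using winding_number_leaf not_leaf by auto
    then have "z \<notin> outside (range (G 1))"
      using winding_number_zero_in_outside[of "G 1" z] path_shift[of 0] by auto
    then have "z \<in> inside (range (G 1))"
      using \<open>z \<notin> range (G 1)\<close> inside_Un_outside by blast
    then show False
      using z by (simp add: annulus_inside_square_def)
  qed
next
  fix z assume "z \<in> (\<Union>r\<in>{0..1}. range (G r))"
  then obtain r x where r: "r \<in> {0..1}" and z: "z = G r x" by blast
  have "z \<notin> inside (range (G 1))"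
  proof (cases "r = 1")
    case True
    then show ?thesis using z inside_no_overlap by blast
  next
    case False
    show ?thesis
    proof
      assume inside: "z \<in> inside (range (G 1))"
      \<comment> \<open>With \<open>x\<close> fixed, lowering \<open>u\<close> from \<open>r\<close>
        to \<open>0\<close> leads from \<open>z\<close> to the boundary and, as
        \<open>r < 1\<close>, avoids the innermost leaf.\<close>
      let ?T = "(\<lambda>u. G u x) ` {0..r}"
      have "continuous_on {0..r} (\<lambda>u. G u x)"
        using r by (intro continuous_on_leaf_comp continuous_intros) auto
      then have "connected ?T"
        by (intro connected_continuous_image) simp_all
      moreover have "?T \<subseteq> - range (G 1)"
        using r False by (auto simp: eq_iff)
      moreover have "z \<in> ?T" "G 0 x \<in> ?T"
        using r z by auto
      ultimately have "connected_component (- range (G 1)) z (G 0 x)"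
        unfolding connected_component_def by blast
      then have "G 0 x \<in> inside (range (G 1))"
        using inside inside_same_component by blast
      moreover have "G 0 x \<notin> interior unit_square"
        using outer unfolding frontier_def by blast
      \<comment> \<open>The interior of the square is convex and contains the innermost leaf, so a
        point off this interior is outside that leaf.\<close>
      then have "G 0 x \<in> outside (range (G 1))"
        using convex_in_outside[of "interior unit_square"] outside_mono[OF inner]
        by (auto simp: unit_square_def)
      ultimately show False
        using inside_Int_outside by blast
    qed
  qed
  then show "z \<in> annulus_inside_square (range (G 1))"
    using in_square[OF r] z by (auto simp: annulus_inside_square_def)
qed

lemma completely_foliated_leaves:
  assumes \<rho>: "continuous_on {0..1} \<rho>" "mono_on {0..1} \<rho>" "\<And>r. r \<in> {0..1} \<Longrightarrow> 0 \<le> \<rho> r \<and> \<rho> r < 1"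
  shows "completely_foliated F (range (G 1)) (\<rho> 0) (\<rho> 1)"
proof -
  have rot: "rotation_number F (range (G r)) = \<rho> r" if "r \<in> {0..1}" for r
    using rotation_number_leaf[OF that] \<rho>(3)[OF that] by (simp add: frac_eq)
  obtain h k where "homeomorphism (sphere 0 1 \<times> {0..1}) (\<Union>r\<in>{0..1}. range (G r)) h k"
    and leaf: "\<And>r. r \<in> {0..1} \<Longrightarrow> h ` (sphere (0::complex) 1 \<times> {r}) = range (G r)"
    by (rule circle_family_homeomorphism[OF cont _ eq_iff]) auto
  then have "homeomorphism (sphere 0 1 \<times> {0..1}) (annulus_inside_square (range (G 1))) h k"
    by (simp add: annulus_eq)
  moreover have "continuous_on {0..1} (\<lambda>r. rotation_number F (h ` (sphere 0 1 \<times> {r})))"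
    using \<rho>(1) by (simp add: leaf rot cong: continuous_on_cong_simp)
  moreover have "mono_on {0..1} (\<lambda>r. rotation_number F (h ` (sphere 0 1 \<times> {r})))"
    using \<rho>(2) by (auto simp: leaf rot monotone_on_def)
  ultimately show ?thesis
    unfolding completely_foliated_def Let_def
    using rotationally_symmetric_leaf leaf rot outer rot[of 0, unfolded outer]
    by (intro exI[of _ h] exI[of _ k]) simp
qed

end

section \<open>The linear map on the cone\<close>

text \<open>As a function of \<open>y\<close> it is constant along lines parallel to
  \<open>x\<close>, so it tells on which side of an edge line a point lies.\<close>

definition cross :: "complex \<Rightarrow> complex \<Rightarrow> real" where
  "cross x y = Re x * Im y - Im x * Re y"

lemma cross_linear:
  "cross x (y + z) = cross x y + cross x z" "cross x (c *\<^sub>R y) = c * cross x y"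
  "cross (y + z) x = cross y x + cross z x" "cross (c *\<^sub>R y) x = c * cross y x"
  "cross x (y - z) = cross x y - cross x z"
  by (simp_all add: cross_def algebra_simps)

lemma cross_skew: "cross x y = - cross y x"
  by (simp add: cross_def)

lemma affine_map_on_hull3:
  assumes "affine_map_on (convex hull {x, y, z}) f" "a \<ge> 0" "b \<ge> 0" "c \<ge> 0" "a + b + c = 1"
  shows "f (a *\<^sub>R x + b *\<^sub>R y + c *\<^sub>R z) = a *\<^sub>R f x + b *\<^sub>R f y + c *\<^sub>R f z"
proof -
  obtain l d where l: "linear l" and f: "\<And>p. p \<in> convex hull {x, y, z} \<Longrightarrow> f p = l p + d"
    using assms(1) unfolding affine_map_on_def by blast
  have "a *\<^sub>R x + b *\<^sub>R y + c *\<^sub>R z \<in> convex hull {x, y, z}"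
    using assms unfolding convex_hull_3 by blast
  moreover have "x \<in> convex hull {x, y, z}" "y \<in> convex hull {x, y, z}" "z \<in> convex hull {x, y, z}"
    by (auto intro: hull_inc)
  moreover have "a *\<^sub>R d + b *\<^sub>R d + c *\<^sub>R d = d"
    using assms(5) by (metis scaleR_add_left scaleR_one)
  ultimately show ?thesis
    by (simp add: f linear_add[OF l] linear_scale[OF l] scaleR_add_right) (metis add.assoc)
qed

lemma R_Complex: "R z = Complex (1 - Im z) (Re z)"
  by (simp add: R_def center_def complex_eq_iff)

lemma R_affine:
  assumes "a + b + c = 1"
  shows "R (a *\<^sub>R x + b *\<^sub>R y + c *\<^sub>R z) = a *\<^sub>R R x + b *\<^sub>R R y + c *\<^sub>R R z"
  unfolding complex_eq_iff R_Complex using assms by (simp, algebra)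

lemma R_pow_affine:
  assumes "a + b + c = 1"
  shows "(R ^^ n) (a *\<^sub>R x + b *\<^sub>R y + c *\<^sub>R z) = a *\<^sub>R (R ^^ n) x + b *\<^sub>R (R ^^ n) y + c *\<^sub>R (R ^^ n) z"
  by (induction n) (simp_all add: R_affine[OF assms])

lemma Re_R [simp]: "Re (R z) = 1 - Im z" and Im_R [simp]: "Im (R z) = Re z"
  by (simp_all add: R_Complex)

lemma R_pow_4: "(R ^^ 4) z = z"
  by (simp add: eval_nat_numeral complex_eq_iff)

lemma mod_4_cases:
  fixes i :: nat
  obtains "i mod 4 = 0" "Suc i mod 4 = 1" | "i mod 4 = 1" "Suc i mod 4 = 2"
    | "i mod 4 = 2" "Suc i mod 4 = 3" | "i mod 4 = 3" "Suc i mod 4 = 0"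
proof -
  have "i mod 4 < 4" by simp
  then have "i mod 4 = 0 \<or> i mod 4 = 1 \<or> i mod 4 = 2 \<or> i mod 4 = 3" by linarith
  then show ?thesis using that by (auto simp: mod_Suc)
qed

lemma R_E: "R (E i) = E (Suc i)"
  by (cases i rule: mod_4_cases) (simp_all add: E_def complex_eq_iff)

lemma R_P: "R (P \<theta> i) = P \<theta> (Suc i)"
  by (cases i rule: mod_4_cases) (simp_all add: P_def Let_def complex_eq_iff)

lemma R_P': "R (P' \<theta> i) = P' \<theta> (Suc i)"
  by (cases i rule: mod_4_cases) (simp_all add: P'_def Let_def complex_eq_iff)

lemma R_pow_E: "(R ^^ n) (E i) = E (i + n)" and R_pow_P: "(R ^^ n) (P \<theta> i) = P \<theta> (i + n)"
  and R_pow_P': "(R ^^ n) (P' \<theta> i) = P' \<theta> (i + n)"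
  by (induction n) (simp_all add: R_E R_P R_P')

lemma is_F_mod_4:
  assumes "is_F \<theta> F"
  shows "F (E i) = E i" "F (P \<theta> i) = P' \<theta> i"
    "affine_map_on (triangle_A \<theta> i) F" "i \<ge> 1 \<Longrightarrow> affine_map_on (triangle_B \<theta> i) F"
proof -
  \<comment> \<open>The representative of \<open>i\<close> among the indices that
    \<open>is_F\<close> covers; \<open>4\<close> instead of \<open>0\<close> keeps
    \<open>j - 1\<close> from truncating.\<close>
  define j where "j = (if i mod 4 = 0 then 4 else i mod 4)"
  have j: "j \<in> {1..4}" "j mod 4 = i mod 4" "Suc j mod 4 = Suc i mod 4"
    by (auto simp: j_def Suc_le_eq mod_Suc)
  have eq: "E j = E i" "E (Suc j) = E (Suc i)" "P \<theta> j = P \<theta> i" "P' \<theta> j = P' \<theta> i"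
    by (simp_all add: E_def P_def P'_def Let_def j)
  then show "F (E i) = E i" "F (P \<theta> i) = P' \<theta> i" "affine_map_on (triangle_A \<theta> i) F"
    using assms j unfolding is_F_def triangle_A_def by (metis Suc_eq_plus1)+
  assume "i \<ge> 1"
  then have "(j - 1) mod 4 = (i - 1) mod 4"
    unfolding j_def by (cases i) (auto simp: mod_Suc)
  then have "P \<theta> (j - 1) = P \<theta> (i - 1)"
    by (simp only: P_def Let_def)
  then show "affine_map_on (triangle_B \<theta> i) F"
    using assms j eq unfolding is_F_def triangle_B_def by metis
qed

text \<open>\<open>R\<close> shifts the indices of the vertices and of their images alike, and both
  \<open>R\<close> and \<open>F\<close> on each piece keep barycentric coordinates; so both sides
  have the same vertex expansion.\<close>

lemma F_R_pow:
  assumes F: "is_F \<theta> F" and z: "z \<in> triangle_A \<theta> 1 \<union> triangle_B \<theta> 1"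
  shows "F ((R ^^ n) z) = (R ^^ n) (F z)"
  using z
proof
  assume "z \<in> triangle_A \<theta> 1"
  then obtain a b c where abc: "a \<ge> 0" "b \<ge> 0" "c \<ge> 0" "a + b + c = 1"
    and z: "z = a *\<^sub>R E 1 + b *\<^sub>R E (1 + 1) + c *\<^sub>R P \<theta> 1"
    unfolding triangle_A_def convex_hull_3 by blast
  have "F ((R ^^ m) z) = a *\<^sub>R E (1 + m) + b *\<^sub>R E (1 + m + 1) + c *\<^sub>R P' \<theta> (1 + m)" for m
    using affine_map_on_hull3[OF is_F_mod_4(3)[OF F, of "1 + m", unfolded triangle_A_def] abc]
    unfolding z R_pow_affine[OF abc(4)] R_pow_E R_pow_P by (simp add: is_F_mod_4[OF F])
  from this[of 0] this[of n] show ?thesis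
    by (simp add: R_pow_affine[OF abc(4)] R_pow_E R_pow_P')
next
  assume "z \<in> triangle_B \<theta> 1"
  then obtain a b c where abc: "a \<ge> 0" "b \<ge> 0" "c \<ge> 0" "a + b + c = 1"
    and z: "z = a *\<^sub>R E 1 + b *\<^sub>R P \<theta> 1 + c *\<^sub>R P \<theta> (1 - 1)"
    unfolding triangle_B_def convex_hull_3 by blast
  have "F ((R ^^ m) z) = a *\<^sub>R E (1 + m) + b *\<^sub>R P' \<theta> (1 + m) + c *\<^sub>R P' \<theta> m" for m
    using affine_map_on_hull3[OF is_F_mod_4(4)[OF F, of "1 + m", unfolded triangle_B_def] abc]
    unfolding z R_pow_affine[OF abc(4)] R_pow_E R_pow_P by (simp add: is_F_mod_4[OF F])
  from this[of 0] this[of n] show ?thesis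
    by (simp add: R_pow_affine[OF abc(4)] R_pow_E R_pow_P')
qed

section \<open>The matrix of the map on the first cone\<close>

locale integrable_zone =
  fixes K :: nat and \<theta> :: real and F :: "complex \<Rightarrow> complex"
  assumes K: "K \<ge> 3"
    and \<theta>: "0 < \<theta>" "\<theta> < pi / 4"
    and F: "is_F \<theta> F"
    and F_pow_B: "\<And>k. k < K \<Longrightarrow> (F ^^ k) ` closed_segment (E 1) (P \<theta> 4) \<subseteq> triangle_B \<theta> 1"
    and F_pow_K: "(F ^^ K) ` closed_segment (E 1) (P \<theta> 4) = closed_segment (E 1) (P \<theta> 1)"
begin

definition t where "t = (sin \<theta>)\<^sup>2"
definition s where "s = sin \<theta> * cos \<theta>"
text \<open>The distance between \<open>P \<theta> 1\<close> and \<open>P' \<theta> 1\<close>, hence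
  the step of the shear at height \<open>t\<close>.\<close>

definition w where "w = 1 - 2 * s"

lemma s_t: "0 < t" "t < s" "0 < w" "s\<^sup>2 + t\<^sup>2 = t"
proof -
  have sin: "0 < sin \<theta>"
    using \<theta> by (intro sin_gt_zero) auto
  have "sin \<theta> < sin (pi / 2 - \<theta>)"
    using \<theta> by (intro sin_monotone_2pi) auto
  then have cos: "sin \<theta> < cos \<theta>"
    by (simp add: cos_sin_eq)
  show "0 < t" "t < s"
    using sin cos by (auto simp: t_def s_def power2_eq_square)
  have "s\<^sup>2 + t\<^sup>2 = (sin \<theta>)\<^sup>2 * ((sin \<theta>)\<^sup>2 + (cos \<theta>)\<^sup>2)"
    by (simp only: s_def t_def power2_eq_square algebra_simps)
  also have "\<dots> = t"
    by (simp add: t_def)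
  finally show "s\<^sup>2 + t\<^sup>2 = t" .
  have "0 < (cos \<theta> - sin \<theta>)\<^sup>2"
    using cos by simp
  also have "\<dots> = w"
    unfolding w_def s_def power2_diff using sin_cos_squared_add[of \<theta>] by (simp add: algebra_simps)
  finally show "0 < w" .
qed

lemma s_less_half: "s < 1 / 2"
  using s_t(3) by (simp add: w_def)

lemma vertices:
  "E 1 = 0" "E (Suc 0) = 0" "E 2 = 1" "E (Suc (Suc 0)) = 1" "P \<theta> 0 = Complex t (1 - s)" "P \<theta> 4 = Complex t (1 - s)" "P \<theta> 1 = Complex s t" "P \<theta> (Suc 0) = Complex s t"
  "P' \<theta> 0 = Complex t s" "P' \<theta> 4 = Complex t s" "P' \<theta> 1 = Complex (1 - s) t"
  "P' \<theta> (Suc 0) = Complex (1 - s) t"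
  by (simp_all add: E_def P_def P'_def Let_def s_def t_def complex_eq_iff)

text \<open>By Cramer's rule the linear map sending \<open>P \<theta> 4\<close>,
  \<open>P \<theta> 1\<close> to \<open>P' \<theta> 4\<close>, \<open>P' \<theta> 1\<close> has rows
  \<open>(p, - q)\<close> and \<open>(q, s + t)\<close>; the denominator \<open>s - t\<close> is the
  determinant of \<open>P \<theta> 1\<close> and \<open>P \<theta> 4\<close>. \<open>T\<close> is
  the trace, which exceeds \<open>2\<close>.\<close>

definition p where "p = ((1 - s)\<^sup>2 - t\<^sup>2) / (s - t)"
definition q where "q = t * w / (s - t)"
definition T where "T = 2 + w\<^sup>2 / (s - t)"

lemma p_q: "p * (s - t) = (1 - s)\<^sup>2 - t\<^sup>2" "q * (s - t) = t * w" "T * (s - t) = 2 * (s - t) + w\<^sup>2"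
  using s_t(2) by (simp_all add: p_def q_def T_def distrib_right)

text \<open>The matrix identities hold only modulo \<open>s\<^sup>2 + t\<^sup>2 = t\<close>: the
  denominator is cleared first, and \<open>c\<close> is the explicit cofactor of the
  relation.\<close>

lemma eq_if_eq_mod_relation:
  assumes "x * (s - t) = X" "X - y * (s - t) = c * (s\<^sup>2 + t\<^sup>2 - t)"
  shows "x = y"
  using assms s_t(2,4) by simp

text \<open>This is the determinant of \<open>A\<close>; its value makes \<open>A\<close> preserve
  \<open>cross\<close>.\<close>

lemma det_A: "p * (s + t) + q\<^sup>2 = 1"
proof -
  have "(p * (s + t) + q\<^sup>2) * (s - t) * (s - t) = p * (s - t) * (s + t) * (s - t) + (q * (s - t))\<^sup>2"
    by (simp add: power2_eq_square algebra_simps)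
  also have "\<dots> - (s - t) * (s - t) = (t + t\<^sup>2 - 2 * s + s\<^sup>2) * (s\<^sup>2 + t\<^sup>2 - t)"
    unfolding p_q by (simp add: w_def power2_eq_square algebra_simps)
  finally have "(p * (s + t) + q\<^sup>2) * (s - t) = s - t"
    using s_t(2,4) by simp
  then show ?thesis using s_t(2) by simp
qed

lemma trace_A: "p + (s + t) = T"
proof (rule eq_if_eq_mod_relation)
  show "(p + (s + t)) * (s - t) = p * (s - t) + (s + t) * (s - t)"
    by (simp add: algebra_simps)
  show "p * (s - t) + (s + t) * (s - t) - T * (s - t) = - 2 * (s\<^sup>2 + t\<^sup>2 - t)"
    unfolding p_q by (simp add: w_def power2_eq_square algebra_simps)
qed

definition A :: "complex \<Rightarrow> complex" where
  "A z = Complex (p * Re z - q * Im z) (q * Re z + (s + t) * Im z)"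

lemma A_add: "A (x + y) = A x + A y" and A_scaleR: "A (c *\<^sub>R x) = c *\<^sub>R A x"
  by (simp_all add: A_def complex_eq_iff algebra_simps)

lemma A_0 [simp]: "A 0 = 0"
  by (simp add: A_def complex_eq_iff)

lemma A_P: "A (P \<theta> 4) = P' \<theta> 4" "A (P \<theta> 1) = P' \<theta> 1"
proof -
  have "p * t - q * (1 - s) = t"
  proof (rule eq_if_eq_mod_relation)
    show "(p * t - q * (1 - s)) * (s - t) = p * (s - t) * t - q * (s - t) * (1 - s)"
      by (simp add: algebra_simps)
    show "p * (s - t) * t - q * (s - t) * (1 - s) - t * (s - t) = - t * (s\<^sup>2 + t\<^sup>2 - t)"
      unfolding p_q by (simp add: w_def power2_eq_square algebra_simps)
  qed
  moreover have "q * t + (s + t) * (1 - s) = s"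
  proof (rule eq_if_eq_mod_relation)
    show "(q * t + (s + t) * (1 - s)) * (s - t) = q * (s - t) * t + (s + t) * (1 - s) * (s - t)"
      by (simp add: algebra_simps)
    show "q * (s - t) * t + (s + t) * (1 - s) * (s - t) - s * (s - t) = - s * (s\<^sup>2 + t\<^sup>2 - t)"
      unfolding p_q by (simp add: w_def power2_eq_square algebra_simps)
  qed
  moreover have "p * s - q * t = (1 - s)"
  proof (rule eq_if_eq_mod_relation)
    show "(p * s - q * t) * (s - t) = p * (s - t) * s - q * (s - t) * t"
      by (simp add: algebra_simps)
    show "p * (s - t) * s - q * (s - t) * t - (1 - s) * (s - t) = (s - 1) * (s\<^sup>2 + t\<^sup>2 - t)"
      unfolding p_q by (simp add: w_def power2_eq_square algebra_simps)
  qed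
  moreover have "q * s + (s + t) * t = t"
  proof (rule eq_if_eq_mod_relation)
    show "(q * s + (s + t) * t) * (s - t) = q * (s - t) * s + (s + t) * t * (s - t)"
      by (simp add: algebra_simps)
    show "q * (s - t) * s + (s + t) * t * (s - t) - t * (s - t) = - t * (s\<^sup>2 + t\<^sup>2 - t)"
      unfolding p_q by (simp add: w_def power2_eq_square algebra_simps)
  qed
  ultimately show "A (P \<theta> 4) = P' \<theta> 4" "A (P \<theta> 1) = P' \<theta> 1"
    by (simp_all add: vertices A_def)
qed

text \<open>Cayley-Hamilton with determinant \<open>1\<close>; it becomes the recursion of the
  edges.\<close>

lemma A_trace: "A (A z) = T *\<^sub>R A z - z"
  unfolding complex_eq_iff A_def complex.sel minus_complex.sel scaleR_complex.sel trace_A[symmetric]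
  using det_A by algebra

lemma cross_A: "cross (A x) (A y) = cross x y"
proof -
  have "cross (A x) (A y) = (p * (s + t) + q\<^sup>2) * cross x y"
    unfolding cross_def A_def complex.sel by algebra
  then show ?thesis by (simp add: det_A)
qed

text \<open>As it fixes \<open>E 1 = 0\<close>, the affine map is linear, and it agrees with
  \<open>A\<close> at the two other vertices.\<close>

lemma F_B: "z \<in> triangle_B \<theta> 1 \<Longrightarrow> F z = A z"
proof -
  assume "z \<in> triangle_B \<theta> 1"
  then obtain a b c where abc: "a \<ge> 0" "b \<ge> 0" "c \<ge> 0" "a + b + c = 1"
    and z: "z = a *\<^sub>R E 1 + b *\<^sub>R P \<theta> 1 + c *\<^sub>R P \<theta> 0"
    unfolding triangle_B_def convex_hull_3 by auto
  have "F z = a *\<^sub>R F (E 1) + b *\<^sub>R F (P \<theta> 1) + c *\<^sub>R F (P \<theta> 0)"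
    unfolding z using is_F_mod_4(4)[OF F, of 1] abc
    by (intro affine_map_on_hull3) (simp_all add: triangle_B_def)
  then have "F z = a *\<^sub>R E 1 + b *\<^sub>R P' \<theta> 1 + c *\<^sub>R P' \<theta> 0"
    unfolding is_F_mod_4[OF F] .
  then show ?thesis
    using A_P unfolding z A_add A_scaleR vertices by simp
qed

text \<open>The base of the triangle, on the real axis, stays fixed, and the apex at height
  \<open>t\<close> moves to the right by \<open>w\<close>.\<close>

lemma F_A: "z \<in> triangle_A \<theta> 1 \<Longrightarrow> F z = z + of_real (w / t * Im z)"
proof -
  assume "z \<in> triangle_A \<theta> 1"
  then obtain a b c where abc: "a \<ge> 0" "b \<ge> 0" "c \<ge> 0" "a + b + c = 1"
    and z: "z = a *\<^sub>R E 1 + b *\<^sub>R E 2 + c *\<^sub>R P \<theta> 1"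
    unfolding triangle_A_def convex_hull_3 by (auto simp: numeral_2_eq_2)
  have "F z = a *\<^sub>R F (E 1) + b *\<^sub>R F (E 2) + c *\<^sub>R F (P \<theta> 1)"
    unfolding z using is_F_mod_4(3)[OF F, of 1] abc
    by (intro affine_map_on_hull3) (simp_all add: triangle_A_def numeral_2_eq_2)
  then have "F z = a *\<^sub>R E 1 + b *\<^sub>R E 2 + c *\<^sub>R P' \<theta> 1"
    unfolding is_F_mod_4[OF F] .
  moreover have "w / t * Im z = c * w"
    using s_t(1) by (simp add: z vertices)
  ultimately show ?thesis
    by (simp add: z vertices complex_eq_iff w_def algebra_simps)
qed

section \<open>Vertices and edges of the orbit polygon\<close>

definition v where "v k = (A ^^ k) (P \<theta> 4)"
text \<open>The vector \<open>Complex 0 (- w)\<close> is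
  \<open>P' \<theta> 4 - P \<theta> 4\<close>, the vertical first edge.\<close>

definition e where "e k = (A ^^ k) (Complex 0 (- w))"

lemma v_Suc: "v (Suc k) = v k + e k"
proof (induction k)
  case 0
  show ?case
    using A_P(1) by (simp add: v_def e_def vertices complex_eq_iff w_def)
next
  case (Suc k)
  then have "A (v (Suc k)) = A (v k) + A (e k)"
    by (simp add: A_add)
  then show ?case by (simp add: v_def e_def)
qed

lemma v_1: "v (Suc 0) = Complex t s"
  using A_P(1) by (simp add: v_def vertices)

lemma F_pow_segment:
  assumes "x \<in> closed_segment (E 1) (P \<theta> 4)" "k \<le> K"
  shows "(F ^^ k) x = (A ^^ k) x"
  using assms(2)
proof (induction k)
  case (Suc k)
  then have "(F ^^ k) x \<in> triangle_B \<theta> 1"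
    using F_pow_B[of k] assms(1) by auto
  then show ?case
    using Suc F_B by simp
qed simp

text \<open>The hypothesis relates the segments only as sets. By linearity \<open>v K\<close> is
  \<open>a\<close> times \<open>P \<theta> 1\<close>, and \<open>P \<theta> 1\<close> is the image
  of \<open>b\<close> times \<open>P \<theta> 4\<close>; neither factor exceeds \<open>1\<close> and
  their product is \<open>1\<close>.\<close>

lemma v_K: "v K = P \<theta> 1"
proof -
  have A_pow: "(A ^^ K) (c *\<^sub>R x) = c *\<^sub>R (A ^^ K) x" for c x
    by (induction K) (simp_all add: A_scaleR)
  have "P \<theta> 4 \<in> closed_segment (E 1) (P \<theta> 4)" "P \<theta> 1 \<in> closed_segment (E 1) (P \<theta> 1)"
    by simp_all
  then have "v K \<in> closed_segment 0 (P \<theta> 1)"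
    using F_pow_K F_pow_segment[of "P \<theta> 4" K] by (metis order_refl v_def vertices(1) imageI)
  then obtain a where a: "a \<le> 1" "v K = a *\<^sub>R P \<theta> 1"
    by (auto simp: in_segment)
  have "P \<theta> 1 \<in> (F ^^ K) ` closed_segment (E 1) (P \<theta> 4)"
    using F_pow_K by simp
  then obtain b where b: "0 \<le> b" "b \<le> 1" "P \<theta> 1 = (A ^^ K) (b *\<^sub>R P \<theta> 4)"
    using F_pow_segment[of _ K] unfolding vertices(1) by (auto simp: in_segment)
  then have "P \<theta> 1 = b *\<^sub>R (a *\<^sub>R P \<theta> 1)"
    using a(2) A_pow[of b "P \<theta> 4"] by (simp add: v_def)
  from arg_cong[OF this, of Re] have "s = b * a * s"
    by (simp add: vertices)
  then have "a * b = 1"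
    using s_t by (simp add: mult.commute)
  then have "a = 1"
    using a b by (smt (verit) mult_left_le mult_nonneg_nonneg mult_le_0_iff)
  then show ?thesis using a by simp
qed

text \<open>\<open>A\<close> sends \<open>v K\<close> to \<open>P' \<theta> 1\<close> at the same
  height, so here the polygon becomes horizontal and enters the zone of the shear.\<close>

lemma e_K: "e K = of_real w"
proof -
  have "v (Suc K) = P' \<theta> 1"
    using A_P(2) v_K by (simp add: v_def)
  then show ?thesis
    using v_Suc[of K] v_K by (simp add: vertices complex_eq_iff w_def algebra_simps)
qed

lemma v_in_B: "k \<le> K \<Longrightarrow> v k \<in> triangle_B \<theta> 1"
proof (cases "k = K")
  case True
  then show ?thesis
    using v_K by (simp add: triangle_B_def hull_inc)
next
  case False
  assume "k \<le> K"
  then show ?thesis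
    using False F_pow_B[of k] F_pow_segment[of "P \<theta> 4" k] by (auto simp: v_def)
qed

lemma e_Suc_Suc: "e (Suc (Suc k)) = T *\<^sub>R e (Suc k) - e k"
  by (simp add: e_def A_trace)

text \<open>As \<open>T\<close> is at least \<open>2\<close>, the recursion makes the sequence
  convex, and it starts with \<open>0\<close> and \<open>q * w > 0\<close>.\<close>

lemma Re_e: "0 \<le> Re (e k) \<and> Re (e k) < Re (e (Suc k))"
proof (induction k)
  case 0
  show ?case
    using s_t by (simp add: e_def A_def q_def)
next
  case (Suc k)
  have "2 * Re (e (Suc k)) \<le> T * Re (e (Suc k))"
    using Suc s_t by (intro mult_right_mono) (auto simp: T_def)
  moreover have "Re (e (Suc (Suc k))) = T * Re (e (Suc k)) - Re (e k)"
    by (simp add: e_Suc_Suc)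
  ultimately show ?case
    using Suc by linarith
qed

lemma Re_e_pos: "k \<ge> 1 \<Longrightarrow> 0 < Re (e k)"
  using Re_e[of "k - 1"] by simp

text \<open>\<open>A\<close> preserves \<open>cross\<close>, so \<open>k\<close> drops out, and
  pairing with the vertical \<open>e 0\<close> reads off a real part. With \<open>Re_e\<close> this
  says that the polygon always turns left.\<close>

lemma cross_e: "cross (e k) (e (k + n)) = w * Re (e n)"
  by (induction k) (simp_all add: e_def cross_A, simp add: cross_def)

lemma cross_e_v_self: "cross (e k) (v k) = w * t"
  by (induction k) (simp_all add: e_def v_def cross_A, simp add: cross_def vertices)

text \<open>Pairing with the horizontal \<open>e K\<close> reads off an imaginary part; real and
  imaginary parts of the edges mirror each other.\<close>

lemma Im_e: "k \<le> K \<Longrightarrow> - Im (e k) = Re (e (K - k))"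
  using cross_e[of k "K - k"] s_t(3) by (simp add: e_K cross_def) (metis mult.commute mult_cancel_left mult_minus_left less_irrefl)

lemma Im_e_nonneg: "k \<le> K \<Longrightarrow> Im (e k) \<le> 0"
  using Im_e[of k] Re_e[of "K - k"] by simp

text \<open>Convexity: from vertex \<open>j\<close> to the next the functional changes by
  \<open>cross (e k) (e j)\<close>, which is nonpositive before \<open>k\<close> and nonnegative
  from \<open>k\<close> on, so the minimum is attained on the edge itself.\<close>

lemma cross_e_v: "cross (e k) (v j) \<ge> w * t"
proof (cases "k \<le> j")
  case True
  then show ?thesis
  proof (induction j rule: dec_induct)
    case (step j)
    then show ?case
      using cross_e[of k "j - k"] Re_e[of "j - k"] s_t(3) by (simp add: v_Suc cross_linear add_increasing2)
  qed (simp add: cross_e_v_self)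
next
  case False
  then have "j \<le> k" by simp
  then show ?thesis
  proof (induction j rule: inc_induct)
    case (step j)
    have "cross (e k) (e j) \<le> 0"
      using cross_e[of j "k - j"] Re_e[of "k - j"] s_t(3) step by (simp add: cross_skew[of "e k"])
    then show ?case
      using step by (simp add: v_Suc cross_linear)
  qed (simp add: cross_e_v_self)
qed

lemma v_mono:
  assumes "j \<le> k" "k \<le> K"
  shows "Re (v j) \<le> Re (v k)" "Im (v k) \<le> Im (v j)"
  using assms
proof (induction k rule: dec_induct)
  case (step k)
  {
    case 1
    then show ?case using step Re_e[of k] by (simp add: v_Suc)
  next
    case 2
    then show ?case using step Im_e_nonneg[of k] by (simp add: v_Suc)
  }
qed auto

text \<open>\<open>v 0\<close> is left out: its height \<open>1 - s\<close> exceeds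
  \<open>s\<close>, and the edge leaving it belongs to the preceding quarter.\<close>

lemma v_bounds:
  assumes "1 \<le> k" "k \<le> K"
  shows "t \<le> Re (v k)" "Re (v k) \<le> s" "t \<le> Im (v k)" "Im (v k) \<le> s"
  using v_mono[of 1 k] v_mono[of k K] assms v_1 v_K by (simp_all add: vertices)

end

section \<open>The leaves\<close>

definition ramp :: "real \<Rightarrow> real \<Rightarrow> real" where
  "ramp c x = min c (max 0 x)"

lemma ramp_simps: "c \<le> x \<Longrightarrow> 0 \<le> c \<Longrightarrow> ramp c x = c" "x \<le> 0 \<Longrightarrow> 0 \<le> c \<Longrightarrow> ramp c x = 0"
  "0 \<le> x \<Longrightarrow> x \<le> c \<Longrightarrow> ramp c x = x"
  by (auto simp: ramp_def)

lemma ramp_mono: "x \<le> y \<Longrightarrow> ramp c x \<le> ramp c y"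
  by (auto simp: ramp_def)

lemma convex_bounds:
  fixes x y :: real
  assumes "0 \<le> \<mu>" "\<mu> \<le> 1"
  shows "a \<le> x \<Longrightarrow> a \<le> y \<Longrightarrow> a \<le> (1 - \<mu>) * x + \<mu> * y" "x \<le> a \<Longrightarrow> y \<le> a \<Longrightarrow> (1 - \<mu>) * x + \<mu> * y \<le> a"
  using assms convex_bound_le[of x a y "1 - \<mu>" \<mu>] convex_bound_le[of "- x" "- a" "- y" "1 - \<mu>" \<mu>] by simp_all

section \<open>One quarter of a leaf\<close>

context integrable_zone
begin

definition M where "M = K - 1"

lemma K_M: "Suc M = K" "2 \<le> M" "real M = real K - 1"
  using K by (auto simp: M_def of_nat_diff)

text \<open>Time is measured so that \<open>F\<close> advances by \<open>r * w\<close>: each edge \<open>r *\<^sub>R e k\<close> takes time \<open>r * w\<close>,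
  and the horizontal remainder is traversed with unit speed. Clamping the times instead of splitting
  into cases makes \<open>\<gamma>\<close> jointly continuous also at \<open>r = 0\<close>.\<close>

definition \<gamma> :: "real \<Rightarrow> real \<Rightarrow> complex" where
  "\<gamma> r l = r *\<^sub>R v 1 + (\<Sum>k<M. (ramp (r * w) (l - real k * (r * w)) / w) *\<^sub>R e (Suc k))
     + of_real (max 0 (l - real M * (r * w)))"

text \<open>The duration of a quarter from \<open>r *\<^sub>R v 1\<close> to its rotated copy:
  \<open>M\<close> edges, then a horizontal part of length \<open>1 - 2 * r * s\<close>, which is
  \<open>r * w + 1 - r\<close>.\<close>

definition L :: "real \<Rightarrow> real" where
  "L r = real K * (r * w) + 1 - r"

lemma L_M: "L r = real M * (r * w) + r * w + 1 - r"
  by (simp add: L_def K_M(3) algebra_simps)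

text \<open>At time \<open>l\<close> the first \<open>n\<close> ramps are saturated, so the sum of
  the completed edges telescopes.\<close>

lemma \<gamma>_partial_sum:
  assumes "0 \<le> r" "real k * (r * w) \<le> l" "n \<le> k"
  shows "(\<Sum>k<n. (ramp (r * w) (l - real k * (r * w)) / w) *\<^sub>R e (Suc k)) = r *\<^sub>R (v (Suc n) - v 1)"
  using assms(3)
proof (induction n)
  case (Suc n)
  have rw: "0 \<le> r * w"
    using assms(1) s_t(3) by simp
  have "real (Suc n) * (r * w) \<le> real k * (r * w)"
    using Suc rw by (intro mult_right_mono) auto
  then have "r * w \<le> l - real n * (r * w)"
    using assms(2) by (simp add: algebra_simps)
  then have "ramp (r * w) (l - real n * (r * w)) / w = r"
    using rw s_t(3) by (simp add: ramp_simps)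
  then show ?case
    using Suc by (simp add: v_Suc[of "Suc n"] algebra_simps)
qed simp

lemma \<gamma>_horizontal:
  assumes "0 \<le> r" "real M * (r * w) \<le> l"
  shows "\<gamma> r l = r *\<^sub>R v K + of_real (l - real M * (r * w))"
  using \<gamma>_partial_sum[OF assms order_refl] assms(2) by (simp add: \<gamma>_def K_M(1) algebra_simps)

lemma \<gamma>_edge:
  assumes r: "0 \<le> r" and k: "k \<le> M" and \<mu>: "0 \<le> \<mu>" "\<mu> \<le> 1"
  shows "\<gamma> r ((real k + \<mu>) * (r * w)) = r *\<^sub>R ((1 - \<mu>) *\<^sub>R v (Suc k) + \<mu> *\<^sub>R v (Suc (Suc k)))"
proof (cases "k = M")
  \<comment> \<open>The horizontal part begins with the edge \<open>e K\<close>; including it lets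
    the image of the last cone edge be an edge again.\<close>
  case True
  have "\<gamma> r ((real M + \<mu>) * (r * w)) = r *\<^sub>R v K + of_real (\<mu> * (r * w))"
    using r s_t(3) \<mu> by (subst \<gamma>_horizontal) (auto simp: distrib_right)
  also have "\<dots> = r *\<^sub>R ((1 - \<mu>) *\<^sub>R v K + \<mu> *\<^sub>R v (Suc K))"
    by (simp add: v_Suc e_K scaleR_conv_of_real algebra_simps)
  finally show ?thesis
    by (simp add: True K_M(1))
next
  case False
  define l where "l = (real k + \<mu>) * (r * w)"
  have rw: "0 \<le> r * w"
    using r s_t(3) by simp
  have l: "real k * (r * w) \<le> l" "l - real k * (r * w) = \<mu> * (r * w)"
    using rw \<mu> by (simp_all add: l_def distrib_right)
  have after: "l \<le> real i * (r * w)" if "k < i" for i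
    unfolding l_def using rw \<mu> that by (intro mult_right_mono) auto
  have "(\<Sum>i<M. (ramp (r * w) (l - real i * (r * w)) / w) *\<^sub>R e (Suc i))
      = (\<Sum>i<Suc k. (ramp (r * w) (l - real i * (r * w)) / w) *\<^sub>R e (Suc i))"
    using False k after rw by (intro sum.mono_neutral_right) (auto simp: ramp_simps)
  also have "\<dots> = r *\<^sub>R (v (Suc k) - v 1) + (ramp (r * w) (\<mu> * (r * w)) / w) *\<^sub>R e (Suc k)"
    using \<gamma>_partial_sum[OF r l(1) order_refl] l(2) by simp
  also have "ramp (r * w) (\<mu> * (r * w)) / w = \<mu> * r"
    using \<mu> rw s_t(3) by (simp add: ramp_simps mult_left_le_one_le)
  finally have "\<gamma> r l = r *\<^sub>R v (Suc k) + (\<mu> * r) *\<^sub>R e (Suc k)"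
    using after[of M] False k by (simp add: \<gamma>_def algebra_simps)
  then show ?thesis
    unfolding l_def[symmetric] v_Suc[of "Suc k"] by (simp add: algebra_simps)
qed

lemma time_cases:
  assumes "0 \<le> r" "0 \<le> l"
  obtains (edge) k \<mu> where "k < M" "0 \<le> \<mu>" "\<mu> < 1" "l = (real k + \<mu>) * (r * w)" "0 < r"
    | (horizontal) "real M * (r * w) \<le> l"
proof (cases "real M * (r * w) \<le> l")
  case False
  then have r: "0 < r"
    using assms by (cases "r = 0") auto
  then have rw: "0 < r * w"
    using s_t(3) by simp
  define x where "x = l / (r * w)"
  have x: "0 \<le> x" "x < real M" "l = x * (r * w)"
    using assms rw r s_t(3) False by (simp_all add: x_def divide_less_eq)
  have "l = (real (nat \<lfloor>x\<rfloor>) + frac x) * (r * w)"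
    using x by (simp add: frac_def)
  moreover have "nat \<lfloor>x\<rfloor> < M"
    using x by linarith
  ultimately show ?thesis
    using edge r frac_ge_0 frac_lt_1 by blast
qed (use horizontal in auto)

lemma r_s_t: "r * s < 1 / 2" "r * t \<le> r * s" if "0 \<le> r" "r \<le> 1"
proof -
  have "r * s \<le> 1 * s"
    using that s_t by (intro mult_right_mono) auto
  then show "r * s < 1 / 2"
    using s_less_half by simp
  show "r * t \<le> r * s"
    using that s_t by (intro mult_left_mono) auto
qed

lemma triangle_B_facts: "convex (triangle_B \<theta> 1)" "E 1 \<in> triangle_B \<theta> 1"
  by (simp_all add: triangle_B_def hull_inc)

lemma L_pos: "0 \<le> r \<Longrightarrow> r \<le> 1 \<Longrightarrow> 0 < L r"
proof -
  assume r: "0 \<le> r" "r \<le> 1"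
  have "0 \<le> real K * (r * w)" "r = 1 \<Longrightarrow> 0 < real K * (r * w)"
    using r s_t(3) K by auto
  then show ?thesis
    using r unfolding L_def by (cases "r = 1") auto
qed

lemma rw_le_L: "0 \<le> r \<Longrightarrow> r \<le> 1 \<Longrightarrow> r * w \<le> L r"
proof -
  assume r: "0 \<le> r" "r \<le> 1"
  have "0 \<le> real M * (r * w)"
    using r s_t(3) by auto
  then show ?thesis
    using r unfolding L_M by linarith
qed

lemma \<gamma>_0: "0 \<le> r \<Longrightarrow> \<gamma> r 0 = r *\<^sub>R v 1"
  using \<gamma>_edge[of r 0 0] by simp

lemma \<gamma>_L: "0 \<le> r \<Longrightarrow> r \<le> 1 \<Longrightarrow> \<gamma> r (L r) = R (\<gamma> r 0)"
  using r_s_t[of r] unfolding \<gamma>_0 v_1 One_nat_def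
  by (subst \<gamma>_horizontal) (auto simp: L_M v_K vertices complex_eq_iff w_def algebra_simps)

lemma \<gamma>_bounds:
  assumes r: "0 \<le> r" "r \<le> 1" and l: "0 \<le> l" "l < L r"
  shows "r * t \<le> Re (\<gamma> r l)" "Re (\<gamma> r l) < 1 - r * s" "r * t \<le> Im (\<gamma> r l)" "Im (\<gamma> r l) \<le> r * s"
proof -
  note rs = r_s_t[OF r]
  have "r * t \<le> Re (\<gamma> r l) \<and> Re (\<gamma> r l) < 1 - r * s \<and> r * t \<le> Im (\<gamma> r l) \<and> Im (\<gamma> r l) \<le> r * s"
    using r(1) l(1)
  proof (cases rule: time_cases)
    case (edge k \<mu>)
    have "Suc k \<le> K" "Suc (Suc k) \<le> K"
      using edge K_M by auto
    note b = v_bounds[OF _ this(1)] v_bounds[OF _ this(2)]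
    have "t \<le> Re ((1 - \<mu>) *\<^sub>R v (Suc k) + \<mu> *\<^sub>R v (Suc (Suc k)))"
      "Re ((1 - \<mu>) *\<^sub>R v (Suc k) + \<mu> *\<^sub>R v (Suc (Suc k))) \<le> s"
      "t \<le> Im ((1 - \<mu>) *\<^sub>R v (Suc k) + \<mu> *\<^sub>R v (Suc (Suc k)))"
      "Im ((1 - \<mu>) *\<^sub>R v (Suc k) + \<mu> *\<^sub>R v (Suc (Suc k))) \<le> s"
      using b edge by (auto intro!: convex_bounds)
    then have "r * t \<le> Re (\<gamma> r l)" "Re (\<gamma> r l) \<le> r * s" "r * t \<le> Im (\<gamma> r l)" "Im (\<gamma> r l) \<le> r * s"
      using edge \<gamma>_edge[OF r(1), of k \<mu>] r by (auto intro!: mult_left_mono)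
    then show "r * t \<le> Re (\<gamma> r l) \<and> Re (\<gamma> r l) < 1 - r * s \<and> r * t \<le> Im (\<gamma> r l) \<and> Im (\<gamma> r l) \<le> r * s"
      using rs by auto
  next
    case horizontal
    have "r * w = r - 2 * (r * s)"
      by (simp add: w_def algebra_simps)
    then show "r * t \<le> Re (\<gamma> r l) \<and> Re (\<gamma> r l) < 1 - r * s \<and> r * t \<le> Im (\<gamma> r l) \<and> Im (\<gamma> r l) \<le> r * s"
      using rs horizontal l unfolding \<gamma>_horizontal[OF r(1) horizontal] L_M v_K vertices by auto
  qed
  then show "r * t \<le> Re (\<gamma> r l)" "Re (\<gamma> r l) < 1 - r * s" "r * t \<le> Im (\<gamma> r l)" "Im (\<gamma> r l) \<le> r * s"
    by auto
qed

section \<open>Supporting lines of a leaf\<close>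

text \<open>For these \<open>k\<close> the coefficients \<open>Re (e k)\<close> and
  \<open>- Im (e k)\<close> are nonnegative, so a point above and to the right of a scaled vertex
  inherits its bound; positivity of \<open>Re (e k)\<close> gives the strict version.\<close>

lemma cross_e_ge:
  assumes "0 \<le> r" "1 \<le> j" "1 \<le> k" "k \<le> K" "r * Re (v j) \<le> Re z" "r * Im (v j) \<le> Im z"
  shows "r * (w * t) \<le> cross (e k) z" "r * Im (v j) < Im z \<Longrightarrow> r * (w * t) < cross (e k) z"
proof -
  have "r * (w * t) \<le> r * cross (e k) (v j)"
    using assms(1) cross_e_v by (intro mult_left_mono)
  also have "\<dots> = Re (e k) * (r * Im (v j)) + (- Im (e k)) * (r * Re (v j))"
    by (simp add: cross_def algebra_simps)
  finally have 1: "r * (w * t) \<le> Re (e k) * (r * Im (v j)) + (- Im (e k)) * (r * Re (v j))" .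
  have 2: "(- Im (e k)) * (r * Re (v j)) \<le> (- Im (e k)) * Re z"
    using assms Im_e_nonneg[of k] by (intro mult_left_mono) auto
  have 3: "cross (e k) z = Re (e k) * Im z + (- Im (e k)) * Re z"
    by (simp add: cross_def)
  have "Re (e k) * (r * Im (v j)) \<le> Re (e k) * Im z"
    using assms Re_e[of k] by (intro mult_left_mono) auto
  then show "r * (w * t) \<le> cross (e k) z"
    using 1 2 3 by linarith
  assume "r * Im (v j) < Im z"
  then have "Re (e k) * (r * Im (v j)) < Re (e k) * Im z"
    using Re_e_pos[OF assms(3)] by simp
  then show "r * (w * t) < cross (e k) z"
    using 1 2 3 by linarith
qed

lemma cross_e_\<gamma>_ge:
  assumes r: "0 \<le> r" "r \<le> 1" and l: "0 \<le> l" "l < L r" and k: "1 \<le> k" "k \<le> K"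
  shows "r * (w * t) \<le> cross (e k) (\<gamma> r l)"
  using r(1) l(1)
proof (cases rule: time_cases)
  case (edge i \<mu>)
  have "w * t \<le> (1 - \<mu>) * cross (e k) (v (Suc i)) + \<mu> * cross (e k) (v (Suc (Suc i)))"
    using edge by (intro convex_bounds cross_e_v) auto
  also have "\<dots> = cross (e k) ((1 - \<mu>) *\<^sub>R v (Suc i) + \<mu> *\<^sub>R v (Suc (Suc i)))"
    by (simp add: cross_linear)
  finally show ?thesis
    using edge \<gamma>_edge[OF r(1), of i \<mu>] r by (auto simp: cross_linear(2) intro!: mult_left_mono)
next
  case horizontal
  then show ?thesis
    using r(1) k K unfolding \<gamma>_horizontal[OF r(1) horizontal]
    by (intro cross_e_ge(1)[of r K k]) auto
qed

text \<open>Each point is on a cone edge or on the horizontal part, which lies on the line of the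
  edge \<open>e K\<close>.\<close>

lemma cross_e_\<gamma>_eq:
  assumes r: "0 \<le> r" "r \<le> 1" and l: "0 \<le> l"
  obtains k where "1 \<le> k" "k \<le> K" "cross (e k) (\<gamma> r l) = r * (w * t)"
  using r(1) l
proof (cases rule: time_cases)
  case (edge i \<mu>)
  have "cross (e (Suc i)) (v (Suc (Suc i))) = w * t"
    using cross_e_v_self[of "Suc i"] cross_e[of "Suc i" 0] by (simp add: v_Suc[of "Suc i"] cross_linear e_def)
  moreover have \<gamma>: "\<gamma> r l = r *\<^sub>R ((1 - \<mu>) *\<^sub>R v (Suc i) + \<mu> *\<^sub>R v (Suc (Suc i)))"
    using edge \<gamma>_edge[OF r(1), of i \<mu>] by simp
  ultimately have "cross (e (Suc i)) (\<gamma> r l) = r * (w * t)"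
    unfolding \<gamma> by (simp add: cross_linear cross_e_v_self algebra_simps)
  then show ?thesis
    using edge K_M by (intro that[of "Suc i"]) auto
next
  case horizontal
  then have "Im (\<gamma> r l) = r * t"
    using \<gamma>_horizontal[OF r(1) horizontal] by (simp add: v_K vertices)
  then show ?thesis
    using K by (intro that[of K]) (auto simp: e_K cross_def)
qed

text \<open>By \<open>\<gamma>_bounds\<close> the rotated points lie above and to the right of
  \<open>r *\<^sub>R v K\<close> or, in the last case, \<open>r *\<^sub>R v 1\<close>. The first
  bound cannot be strict: the next quarter starts on the line of \<open>e K\<close>.\<close>

lemma cross_e_R_\<gamma>:
  assumes r: "0 \<le> r" "r \<le> 1" and l: "0 \<le> l" "l < L r" and k: "1 \<le> k" "k \<le> K"
  shows "r * (w * t) \<le> cross (e k) (R (\<gamma> r l))"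
    and "r * (w * t) < cross (e k) (R (R (\<gamma> r l)))"
    and "r * (w * t) < cross (e k) (R (R (R (\<gamma> r l))))"
proof -
  note b = \<gamma>_bounds[OF r l]
  note rs = r_s_t[OF r]
  show "r * (w * t) \<le> cross (e k) (R (\<gamma> r l))"
    using b rs r K k by (intro cross_e_ge(1)[of r K]) (auto simp: v_K vertices)
  show "r * (w * t) < cross (e k) (R (R (\<gamma> r l)))"
    using b rs r K k by (intro cross_e_ge(2)[of r K]) (auto simp: v_K vertices)
  show "r * (w * t) < cross (e k) (R (R (R (\<gamma> r l))))"
    using b rs r K k by (intro cross_e_ge(2)[of r 1]) (auto simp: v_1 vertices)
qed

text \<open>\<open>Re - Im\<close> strictly increases along the quarter: its edges have positive
  real and nonpositive imaginary part, and the horizontal part runs to the right.\<close>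

lemma \<gamma>_inj:
  assumes r: "0 \<le> r" and l: "0 \<le> l" "l < l'"
  shows "\<gamma> r l \<noteq> \<gamma> r l'"
proof -
  define c where "c k = (Re (e (Suc k)) - Im (e (Suc k))) / w" for k
  have c: "0 < c k" if "k < M" for k
    using that Re_e_pos[of "Suc k"] Im_e_nonneg[of "Suc k"] K_M s_t(3) by (simp add: c_def)
  have f: "Re (\<gamma> r l) - Im (\<gamma> r l) = r * (t - s) + (\<Sum>k<M. ramp (r * w) (l - real k * (r * w)) * c k)
      + max 0 (l - real M * (r * w))" for l
    by (simp add: \<gamma>_def v_1 c_def sum_subtractf[symmetric] algebra_simps diff_divide_distrib sum.distrib[symmetric] Re_sum Im_sum)
  have le: "ramp (r * w) (l - real k * (r * w)) * c k \<le> ramp (r * w) (l' - real k * (r * w)) * c k" if "k < M" for k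
    using c[OF that] l by (intro mult_right_mono ramp_mono) auto
  have "Re (\<gamma> r l) - Im (\<gamma> r l) < Re (\<gamma> r l') - Im (\<gamma> r l')"
    using r l(1)
  proof (cases rule: time_cases)
    case (edge k \<mu>)
    have rw: "0 < r * w" using edge s_t by simp
    have "l - real k * (r * w) = \<mu> * (r * w)"
      using edge by (simp add: distrib_right)
    moreover have "\<mu> * (r * w) < r * w" "0 \<le> \<mu> * (r * w)"
      using edge rw mult_strict_right_mono[OF edge(3) rw] by simp_all
    ultimately have "ramp (r * w) (l - real k * (r * w)) < ramp (r * w) (l' - real k * (r * w))"
      using l by (simp add: ramp_def)
    then have "ramp (r * w) (l - real k * (r * w)) * c k < ramp (r * w) (l' - real k * (r * w)) * c k"
      using c[of k] edge by simp
    then have "(\<Sum>k<M. ramp (r * w) (l - real k * (r * w)) * c k)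
        < (\<Sum>k<M. ramp (r * w) (l' - real k * (r * w)) * c k)"
      using edge le by (intro sum_strict_mono_ex1) auto
    then show ?thesis
      unfolding f using l by (auto simp: max_def)
  next
    case horizontal
    have "(\<Sum>k<M. ramp (r * w) (l - real k * (r * w)) * c k)
        \<le> (\<Sum>k<M. ramp (r * w) (l' - real k * (r * w)) * c k)"
      by (intro sum_mono le) simp
    then show ?thesis
      unfolding f using l horizontal by auto
  qed
  then show ?thesis by auto
qed

lemma continuous_on_\<gamma> [continuous_intros]:
  assumes "continuous_on S f" "continuous_on S g"
  shows "continuous_on S (\<lambda>x. \<gamma> (f x) (g x))"
  unfolding \<gamma>_def ramp_def using s_t(3) by (intro continuous_intros assms) auto

section \<open>The action of the map on a quarter\<close>

text \<open>\<open>A\<close> carries each edge affinely onto the next, and the shear moves the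
  horizontal part at height \<open>r * t\<close> by \<open>r * w\<close>. The membership lets
  \<open>F_R_pow\<close> transfer this to the other quarters.\<close>

lemma F_\<gamma>:
  assumes r: "0 \<le> r" "r \<le> 1" and l: "0 \<le> l" "l + r * w \<le> L r"
  shows "\<gamma> r l \<in> triangle_A \<theta> 1 \<union> triangle_B \<theta> 1 \<and> F (\<gamma> r l) = \<gamma> r (l + r * w)"
  using r(1) l(1)
proof (cases rule: time_cases)
  case (edge k \<mu>)
  define z where "z = (1 - \<mu>) *\<^sub>R v (Suc k) + \<mu> *\<^sub>R v (Suc (Suc k))"
  \<comment> \<open>As \<open>E 1 = 0\<close>, the extra summand leaves the value unchanged and
    exhibits a convex combination in the triangle.\<close>
  have \<gamma>: "\<gamma> r l = (1 - r) *\<^sub>R E 1 + r *\<^sub>R z"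
    using \<gamma>_edge[OF r(1), of k \<mu>] edge by (simp add: z_def vertices)
  have "z \<in> triangle_B \<theta> 1"
    unfolding z_def using edge K_M v_in_B by (intro convexD[OF triangle_B_facts(1)]) auto
  then have B: "\<gamma> r l \<in> triangle_B \<theta> 1"
    unfolding \<gamma> using r triangle_B_facts by (intro convexD[OF triangle_B_facts(1)]) auto
  have "F (\<gamma> r l) = r *\<^sub>R ((1 - \<mu>) *\<^sub>R v (Suc (Suc k)) + \<mu> *\<^sub>R v (Suc (Suc (Suc k))))"
    unfolding F_B[OF B] unfolding \<gamma> z_def vertices by (simp add: A_add A_scaleR v_def)
  also have "\<dots> = \<gamma> r ((real (Suc k) + \<mu>) * (r * w))"
    using edge r by (intro \<gamma>_edge[symmetric]) auto
  also have "(real (Suc k) + \<mu>) * (r * w) = l + r * w"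
    using edge by (simp add: algebra_simps)
  finally show ?thesis using B by simp
next
  case horizontal
  define y where "y = l - real M * (r * w)"
  have \<gamma>: "\<gamma> r l = (1 - r - y) *\<^sub>R E 1 + y *\<^sub>R E 2 + r *\<^sub>R P \<theta> 1"
    using \<gamma>_horizontal[OF r(1) horizontal] v_K by (simp add: vertices y_def scaleR_conv_of_real)
  have "0 \<le> y" "y \<le> 1 - r"
    using horizontal l by (auto simp: y_def L_M)
  then have tA: "\<gamma> r l \<in> triangle_A \<theta> 1"
    unfolding triangle_A_def convex_hull_3 \<gamma> using r by (force simp: numeral_2_eq_2)
  have "w / t * Im (\<gamma> r l) = r * w"
    unfolding \<gamma> vertices using s_t(1) by simp
  then have "F (\<gamma> r l) = \<gamma> r l + of_real (r * w)"
    using F_A[OF tA] by simp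
  also have "\<dots> = \<gamma> r (l + r * w)"
  proof -
    have *: "real M * (r * w) \<le> l + r * w"
      using horizontal r s_t(3) by (simp add: add_increasing2)
    show ?thesis
      unfolding \<gamma>_horizontal[OF r(1) horizontal] \<gamma>_horizontal[OF r(1) *] by simp
  qed
  finally show ?thesis using tA by simp
qed

text \<open>The last \<open>r * w\<close> units of time on the quarter are the rotated edge from \<open>v 0\<close> to \<open>v 1\<close>, on
  which \<open>F\<close> is conjugate by \<open>R\<close> to the linear map \<open>A\<close>.\<close>

lemma F_\<gamma>_overflow:
  assumes r: "0 \<le> r" "r \<le> 1" and l: "l < L r" "L r \<le> l + r * w"
  shows "F ((R ^^ n) (\<gamma> r l)) = (R ^^ Suc n) (\<gamma> r (l + r * w - L r))"
proof -
  have rw: "0 < r * w"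
    using r l by linarith
  \<comment> \<open>The fraction of the rotated edge already covered at time \<open>l\<close>;
    \<open>z\<close> below is the point turned back into the first cone.\<close>
  define \<mu> where "\<mu> = (l + r * w - L r) / (r * w)"
  have r0: "0 < r"
    using r rw by (cases "r = 0") auto
  have \<mu>: "0 \<le> \<mu>" "\<mu> \<le> 1" and \<mu>_rw: "\<mu> * (r * w) = l + r * w - L r"
    using rw l r0 s_t(3) by (auto simp: \<mu>_def)
  define z where "z = (1 - r) *\<^sub>R E 1 + r *\<^sub>R ((1 - \<mu>) *\<^sub>R v 0 + \<mu> *\<^sub>R v 1)"
  have B: "z \<in> triangle_B \<theta> 1"
  proof -
    have *: "(1 - \<mu>) *\<^sub>R v 0 + \<mu> *\<^sub>R v 1 \<in> triangle_B \<theta> 1"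
      using \<mu> K v_in_B[of 0] v_in_B[of 1] by (intro convexD[OF triangle_B_facts(1)]) auto
    show ?thesis
      unfolding z_def by (rule convexD[OF triangle_B_facts(1)]) (use * r triangle_B_facts(2) in auto)
  qed
  have "real M * (r * w) \<le> l"
    using l r by (simp add: L_M)
  then have "\<gamma> r l = r *\<^sub>R v K + of_real (l - real M * (r * w))"
    by (rule \<gamma>_horizontal[OF r(1)])
  also have "l - real M * (r * w) = \<mu> * (r * w) + 1 - r"
    unfolding \<mu>_rw L_M by simp
  also have "r *\<^sub>R v K + of_real (\<mu> * (r * w) + 1 - r) = R z"
    by (simp add: z_def v_K v_1 v_def[of 0] vertices complex_eq_iff w_def algebra_simps)
  finally have "(R ^^ n) (\<gamma> r l) = (R ^^ Suc n) z"
    by (simp add: funpow_swap1)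
  then have "F ((R ^^ n) (\<gamma> r l)) = (R ^^ Suc n) (A z)"
    using F_R_pow[OF F, of z "Suc n"] B F_B by simp
  also have "A z = r *\<^sub>R ((1 - \<mu>) *\<^sub>R v (Suc 0) + \<mu> *\<^sub>R v (Suc (Suc 0)))"
    by (simp add: z_def vertices A_add A_scaleR v_def)
  also have "\<dots> = \<gamma> r ((real 0 + \<mu>) * (r * w))"
    using \<mu> r by (intro \<gamma>_edge[symmetric]) auto
  also have "(real 0 + \<mu>) * (r * w) = l + r * w - L r"
    using \<mu>_rw by simp
  finally show ?thesis .
qed

section \<open>Whole leaves\<close>

text \<open>One unit of \<open>u\<close> is a quarter of the leaf, so the period is \<open>4\<close>
  and the leaves use \<open>4 * x\<close>. Reduction modulo \<open>4\<close> gives negative floors a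
  natural exponent.\<close>

definition H :: "real \<Rightarrow> real \<Rightarrow> complex" where
  "H r u = (R ^^ nat (\<lfloor>u\<rfloor> mod 4)) (\<gamma> r (frac u * L r))"

lemma R_pow_mod_4: "(R ^^ (n mod 4)) z = (R ^^ n) z"
proof -
  have "(R ^^ (4 * m)) z = z" for m z
    by (induction m) (simp_all add: funpow_add R_pow_4)
  then show ?thesis
    using mult_div_mod_eq[of 4 n] by (metis comp_apply funpow_add add.commute)
qed

lemma R_pow_inverse: "j < 4 \<Longrightarrow> (R ^^ (4 - j)) ((R ^^ j) z) = z"
  using R_pow_4[of z] funpow_add[of "4 - j" j R] by (simp add: fun_eq_iff)

lemma R_pow_int_Suc: "(R ^^ nat ((n + 1) mod 4)) z = R ((R ^^ nat (n mod 4)) z)"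
proof -
  have "nat ((n + 1) mod 4) = Suc (nat (n mod 4)) mod 4"
    by (simp add: nat_mod_distrib[symmetric] Suc_nat_eq_nat_zadd1 mod_add_right_eq nat_mod_as_int add.commute)
  then show ?thesis
    using R_pow_mod_4[of "Suc (nat (n mod 4))" z] by simp
qed

lemma H_floor: "u \<in> {of_int n..<of_int n + 1} \<Longrightarrow> H r u = (R ^^ nat (n mod 4)) (\<gamma> r ((u - of_int n) * L r))"
proof -
  assume "u \<in> {of_int n..<of_int n + 1}"
  then have "\<lfloor>u\<rfloor> = n" by (simp add: floor_eq_iff)
  then show ?thesis by (simp add: H_def frac_def)
qed

lemma H_add_1: "H r (u + 1) = R (H r u)"
  using R_pow_int_Suc[of "\<lfloor>u\<rfloor>"] by (simp add: H_def frac_1_eq)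

lemma H_add_nat: "H r (u + real n) = (R ^^ n) (H r u)"
  by (induction n) (simp_all add: H_add_1 flip: add.assoc, metis H_add_1 add.commute add.left_commute)

text \<open>By \<open>\<gamma>_L\<close> a quarter ends where its rotated copy starts, so the
  formula extends to the right endpoint, as gluing over closed intervals requires.\<close>

lemma H_interval:
  assumes "0 \<le> r" "r \<le> 1" "u \<in> {of_int n..of_int n + 1}"
  shows "H r u = (R ^^ nat (n mod 4)) (\<gamma> r ((u - of_int n) * L r))"
proof (cases "u = of_int n + 1")
  case True
  have "H r (of_int n + 1) = R (H r (of_int n))"
    by (rule H_add_1)
  also have "H r (of_int n) = (R ^^ nat (n mod 4)) (\<gamma> r 0)"
    using H_floor[of "of_int n" n r] by simp
  finally show ?thesis
    using \<gamma>_L[OF assms(1,2)] True by (simp add: funpow_swap1)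
qed (use assms H_floor in auto)

lemma H_unit: "0 \<le> u \<Longrightarrow> u < 1 \<Longrightarrow> H r u = \<gamma> r (u * L r)"
  using H_floor[of u 0 r] by simp

lemma H_periodic: "H r (u + 4) = H r u"
  using H_add_nat[of r u 4] R_pow_4 by simp

lemma continuous_on_H: "continuous_on ({0..1} \<times> UNIV) (\<lambda>(r, u). H r u)"
proof (rule continuous_on_times_real_if_intervals)
  fix n :: int
  have R_pow: "continuous_on S (\<lambda>x. (R ^^ m) (f x))" if "continuous_on S f" for S :: "(real \<times> real) set" and f m
  proof (induction m)
    case (Suc m)
    then show ?case by (auto simp: R_def intro!: continuous_intros)
  qed (use that in simp)
  have "continuous_on ({0..1} \<times> {of_int n..of_int n + 1})
      (\<lambda>p. (R ^^ nat (n mod 4)) (\<gamma> (fst p) ((snd p - of_int n) * L (fst p))))"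
    unfolding L_def by (intro R_pow continuous_intros)
  then show "continuous_on ({0..1} \<times> {of_int n..of_int n + 1}) (\<lambda>(r, u). H r u)"
    by (rule continuous_on_eq) (auto simp: H_interval)
qed

lemma cross_e_H:
  assumes r: "0 \<le> r" "r \<le> 1" and k: "1 \<le> k" "k \<le> K"
  shows "r * (w * t) \<le> cross (e k) (H r u)"
proof -
  have "frac u * L r < L r" "0 \<le> frac u * L r"
    using L_pos[OF r] frac_lt_1[of u] by auto
  note ge = cross_e_\<gamma>_ge[OF r this(2,1) k] cross_e_R_\<gamma>[OF r this(2,1) k]
  have "nat (\<lfloor>u\<rfloor> mod 4) < 4"
    by (simp add: nat_less_iff)
  then have "nat (\<lfloor>u\<rfloor> mod 4) \<in> {0, 1, 2, 3}"
    by auto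
  then show ?thesis
    using ge by (auto simp: H_def eval_nat_numeral)
qed

lemma cross_e_H_strict:
  assumes r: "0 \<le> r" "r \<le> 1" and k: "1 \<le> k" "k \<le> K" and u: "0 \<le> u" "u < 1"
  shows "r * (w * t) < cross (e k) (R (R (H r u)))" "r * (w * t) < cross (e k) (R (R (R (H r u))))"
  using cross_e_R_\<gamma>(2,3)[OF r _ _ k, of "u * L r"] H_unit[OF u] L_pos[OF r] u by auto

lemma H_eq_imp_le:
  assumes r: "0 \<le> r" "r \<le> 1" and r': "0 \<le> r'" "r' \<le> 1" and eq: "H r u = H r' u'"
  shows "r' \<le> r"
proof -
  have "frac u * L r < L r" "0 \<le> frac u * L r"
    using L_pos[OF r] frac_lt_1[of u] by auto
  then obtain k where k: "1 \<le> k" "k \<le> K" "cross (e k) (\<gamma> r (frac u * L r)) = r * (w * t)"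
    using cross_e_\<gamma>_eq[OF r] by blast
  \<comment> \<open>Both sides are rotated until the point of leaf \<open>r\<close> is in the first
    quarter, where its edge line is available.\<close>
  obtain m where m: "H r (u + real m) = \<gamma> r (frac u * L r)"
  proof
    let ?j = "nat (\<lfloor>u\<rfloor> mod 4)"
    have "?j < 4"
      by (simp add: nat_less_iff)
    then show "H r (u + real (4 - ?j)) = \<gamma> r (frac u * L r)"
      unfolding H_add_nat by (simp add: H_def R_pow_inverse)
  qed
  have "H r (u + real m) = H r' (u' + real m)"
    by (simp add: H_add_nat eq)
  then have "r' * (w * t) \<le> r * (w * t)"
    using cross_e_H[OF r' k(1,2), of "u' + real m"] k(3) m by simp
  then show ?thesis
    using s_t by simp
qed

lemma R_pow_cong: "(R ^^ n) x = (R ^^ n) y \<Longrightarrow> x = y"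
  by (induction n) (auto simp: complex_eq_iff)

text \<open>Two quarters of a leaf cannot meet: a point of the first lies on one of the edges \<open>e k\<close>, from
  which the next two quarters are strictly separated; the case of the last quarter is symmetric.\<close>

lemma H_eq_quarters:
  assumes r: "0 \<le> r" "r \<le> 1" and u: "0 \<le> u" "u < 1" and u': "0 \<le> u'" "u' < 1"
    and d: "d < 4" and eq: "H r u = (R ^^ d) (H r u')"
  shows "d = 0 \<and> u = u'"
proof -
  have touch: "\<exists>k\<ge>1. k \<le> K \<and> cross (e k) (H r u) = r * (w * t)" if u: "0 \<le> u" "u < 1" for u
    using cross_e_\<gamma>_eq[OF r, of "u * L r"] u H_unit[OF u] L_pos[OF r] by auto
  have no: "H r a \<noteq> R (R (H r b))" "H r a \<noteq> R (R (R (H r b)))"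
    if "0 \<le> a" "a < 1" "0 \<le> b" "b < 1" for a b
    using touch[of a] cross_e_H_strict[OF r _ _ that(3,4)] that by (metis less_irrefl)+
  have "d = 0 \<or> d = 1 \<or> d = 2 \<or> d = 3"
    using d by auto
  moreover have "d \<noteq> 1"
  proof
    assume "d = 1"
    \<comment> \<open>Three more quarter turns exchange the roles of \<open>u\<close> and
      \<open>u'\<close>.\<close>
    then have "R (R (R (H r u))) = (R ^^ 4) (H r u')"
      using eq by (simp add: eval_nat_numeral)
    then show False
      using no(2)[OF u' u] by (simp add: R_pow_4)
  qed
  moreover have "d \<noteq> 2" "d \<noteq> 3"
    using eq no[OF u u'] by (auto simp: eval_nat_numeral)
  ultimately have "d = 0" by blast
  then have "\<gamma> r (u * L r) = \<gamma> r (u' * L r)"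
    using eq H_unit u u' by simp
  moreover have "a < b \<Longrightarrow> 0 \<le> a \<Longrightarrow> \<gamma> r (a * L r) \<noteq> \<gamma> r (b * L r)" for a b
    using \<gamma>_inj[OF r(1)] L_pos[OF r] by simp
  ultimately show ?thesis
    using \<open>d = 0\<close> u u' by (metis linorder_neqE_linordered_idom)
qed

lemma H_inj:
  assumes r: "0 \<le> r" "r \<le> 1" and eq: "H r u = H r u'"
  shows "(u - u') / 4 \<in> \<int>"
proof -
  define n n' where "n = \<lfloor>u\<rfloor>" and "n' = \<lfloor>u'\<rfloor>"
  define j j' where "j = nat (n mod 4)" and "j' = nat (n' mod 4)"
  \<comment> \<open>The number of quarter turns from the quarter of \<open>u\<close> to that of
    \<open>u'\<close>; adding \<open>4 - j\<close> avoids truncated subtraction.\<close>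
  define d where "d = (j' + (4 - j)) mod 4"
  have j: "j < 4" "j' < 4"
    by (simp_all add: j_def j'_def nat_less_iff)
  have "(R ^^ j) (H r (frac u)) = (R ^^ j') (H r (frac u'))"
    using eq by (simp add: H_def n_def n'_def j_def j'_def frac_lt_1)
  then have "(R ^^ (4 - j)) ((R ^^ j) (H r (frac u))) = (R ^^ (4 - j)) ((R ^^ j') (H r (frac u')))"
    by simp
  moreover have "(R ^^ (4 - j)) ((R ^^ j) z) = z" for z
    using j(1) by (rule R_pow_inverse)
  moreover have "(R ^^ (4 - j)) ((R ^^ j') z) = (R ^^ d) z" for z
    by (simp add: d_def R_pow_mod_4 add.commute[of j'] funpow_add)
  ultimately have "H r (frac u) = (R ^^ d) (H r (frac u'))"
    by simp
  then have d: "d = 0" and "frac u = frac u'"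
    using H_eq_quarters[OF r, of "frac u" "frac u'" d] by (auto simp: d_def frac_lt_1)
  then have "u - u' = of_int (n - n')"
    by (simp add: frac_def n_def n'_def)
  moreover have "j = j'"
    using d j unfolding d_def by presburger
  then have "n mod 4 = n' mod 4"
    by (simp add: j_def j'_def)
  then obtain k where "n - n' = 4 * k"
    by (metis mod_eq_dvd_iff dvdE)
  ultimately have "(u - u') / 4 = of_int k"
    by simp
  then show ?thesis
    by simp
qed

lemma F_H:
  assumes r: "0 \<le> r" "r \<le> 1"
  shows "F (H r u) = H r (u + r * w / L r)"
proof -
  define n l where "n = \<lfloor>u\<rfloor>" and "l = frac u * L r"
  note L = L_pos[OF r]
  have l: "0 \<le> l" "l < L r"
    using L frac_lt_1[of u] by (simp_all add: l_def)
  have u: "u = of_int n + l / L r"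
    using L by (simp add: n_def l_def frac_def)
  have H: "H r u = (R ^^ nat (n mod 4)) (\<gamma> r l)"
    by (simp add: H_def n_def l_def)
  have u': "(u + r * w / L r - of_int n) * L r = l + r * w"
    using L by (simp add: u field_simps)
  have rw: "0 \<le> r * w"
    using r s_t by simp
  show ?thesis
  proof (cases "l + r * w \<le> L r")
    case True
    have "(l + r * w) / L r \<le> 1"
      using True L by simp
    then have "u + r * w / L r \<in> {of_int n..of_int n + 1}"
      using l rw L by (auto simp: u add_divide_distrib)
    then have "H r (u + r * w / L r) = (R ^^ nat (n mod 4)) (\<gamma> r (l + r * w))"
      using H_interval[OF r] u' by metis
    then show ?thesis
      unfolding H using F_\<gamma>[OF r l(1) True] F_R_pow[OF F] by simp
  next
    case False
    \<comment> \<open>By \<open>rw_le_L\<close> a step never leads beyond the following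
      quarter.\<close>
    have "(l + r * w) / L r \<ge> 1" "(l + r * w) / L r \<le> 2"
      using False l L rw_le_L[OF r] by (auto simp: divide_le_eq)
    then have "u + r * w / L r \<in> {of_int (n + 1)..of_int (n + 1) + 1}"
      by (auto simp: u add_divide_distrib)
    then have "H r (u + r * w / L r) = (R ^^ nat ((n + 1) mod 4)) (\<gamma> r ((u + r * w / L r - of_int (n + 1)) * L r))"
      by (rule H_interval[OF r])
    also have "(u + r * w / L r - of_int (n + 1)) * L r = l + r * w - L r"
      using u' by (simp add: algebra_simps)
    also have "(R ^^ nat ((n + 1) mod 4)) (\<gamma> r (l + r * w - L r)) = F (H r u)"
      using F_\<gamma>_overflow[OF r l(2)] False by (simp add: H R_pow_int_Suc)
    finally show ?thesis by simp
  qed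
qed

text \<open>The horizontal edge \<open>e K\<close> bounds heights from below; the same bound at the
  three rotated points gives the other sides.\<close>

lemma H_bounds:
  assumes r: "0 \<le> r" "r \<le> 1"
  shows "H r u \<in> cbox (Complex (r * t) (r * t)) (Complex (1 - r * t) (1 - r * t))"
proof -
  have Im: "r * t \<le> Im (H r u)" for u
    using cross_e_H[OF r, of K u] K s_t(3) by (simp add: e_K cross_def mult.left_commute[of r w])
  from Im[of u] Im[of "u + 1"] Im[of "u + 1 + 1"] Im[of "u + 1 + 1 + 1"] show ?thesis
    unfolding H_add_1 by (simp add: in_cbox_complex_iff)
qed

text \<open>The center lies above and to the right of \<open>v K\<close>, hence strictly beyond
  every edge line of the innermost leaf, and even more so for smaller \<open>r\<close>.\<close>

lemma center_not_H: "0 \<le> r \<Longrightarrow> r \<le> 1 \<Longrightarrow> H r u \<noteq> center"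
proof
  assume r: "0 \<le> r" "r \<le> 1" and eq: "H r u = center"
  have R_center: "(R ^^ n) center = center" for n
    by (induction n) (simp_all add: R_def)
  have "\<gamma> r (frac u * L r) = center"
    using eq R_center unfolding H_def by (metis R_pow_cong)
  then obtain k where k: "1 \<le> k" "k \<le> K" "cross (e k) center = r * (w * t)"
    using cross_e_\<gamma>_eq[OF r, of "frac u * L r"] L_pos[OF r] by auto
  have "1 * (w * t) < cross (e k) center"
    using s_t s_less_half k K by (intro cross_e_ge(2)[of 1 K]) (auto simp: v_K vertices center_def)
  moreover have "r * (w * t) \<le> 1 * (w * t)"
    using r s_t by (intro mult_right_mono) auto
  ultimately show False
    using k(3) by simp
qed

section \<open>The boundary of the square as the outermost leaf\<close>

lemma H_0: "x \<in> {0..1} \<Longrightarrow> H 0 (real j + x) = linepath (E (1 + j)) (E (2 + j)) x"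
proof -
  assume x: "x \<in> {0..1}"
  have "H 0 x = \<gamma> 0 (x * L 0)"
    using H_interval[of 0 x 0] x by simp
  also have "\<dots> = (1 - x) *\<^sub>R E 1 + x *\<^sub>R E 2 + 0 *\<^sub>R 0"
    using x by (subst \<gamma>_horizontal) (auto simp: L_def vertices scaleR_conv_of_real)
  finally have "H 0 (x + real j) = (R ^^ j) ((1 - x) *\<^sub>R E 1 + x *\<^sub>R E 2 + 0 *\<^sub>R 0)"
    by (simp add: H_add_nat)
  also have "\<dots> = (1 - x) *\<^sub>R E (1 + j) + x *\<^sub>R E (2 + j)"
    by (subst R_pow_affine) (simp_all add: R_pow_E)
  finally show ?thesis
    by (simp add: linepath_def add.commute)
qed

lemma rectpath_eq: "rectpath (Complex 0 0) (Complex 1 1) =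
    linepath (E 1) (E 2) +++ linepath (E 2) (E 3) +++ linepath (E 3) (E 4) +++ linepath (E 4) (E 5)"
  by (simp add: rectpath_def Let_def E_def)

lemma range_H_0: "range (H 0) = frontier unit_square"
proof -
  have seg: "closed_segment (E (1 + j)) (E (2 + j)) \<subseteq> range (H 0)" for j
  proof -
    have "(\<lambda>x. H 0 (real j + x)) ` {0..1} = closed_segment (E (1 + j)) (E (2 + j))"
      unfolding linepath_image_01[symmetric] by (intro image_cong) (simp_all add: H_0)
    then show ?thesis by blast
  qed
  have "range (H 0) = (\<Union>j\<in>{0, 1, 2, 3}. closed_segment (E (1 + j)) (E (2 + j)))"
  proof (intro equalityI subsetI)
    fix z assume "z \<in> range (H 0)"
    then obtain u where "z = H 0 u" by blast
    moreover define j where "j = nat (\<lfloor>u\<rfloor> mod 4)"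
    ultimately have "z = H 0 (real j + frac u)"
      by (simp add: H_add_nat add.commute[of "real j"]) (simp add: H_def j_def frac_lt_1)
    also have "\<dots> \<in> closed_segment (E (1 + j)) (E (2 + j))"
      unfolding linepath_image_01[symmetric] using frac_lt_1[of u] by (auto simp: H_0 less_imp_le)
    finally have "z \<in> closed_segment (E (1 + j)) (E (2 + j))" .
    moreover have "j < 4"
      by (simp add: j_def nat_less_iff)
    then have "j \<in> {0, 1, 2, 3}"
      by auto
    ultimately show "z \<in> (\<Union>j\<in>{0, 1, 2, 3}. closed_segment (E (1 + j)) (E (2 + j)))"
      by blast
  qed (use seg in blast)
  also have "\<dots> = path_image (rectpath (Complex 0 0) (Complex 1 1))"
    unfolding rectpath_eq by (simp add: path_image_join Un_assoc eval_nat_numeral)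
  also have "\<dots> = frontier unit_square"
    unfolding unit_square_def frontier_cbox by (rule path_image_rectpath_cbox_minus_box) auto
  finally show ?thesis .
qed

text \<open>Cut at the corners, the loop consists of the four sides of \<open>rectpath\<close>,
  whose winding number is known; winding numbers add up.\<close>

lemma winding_number_H_0:
  assumes z: "z \<in> interior unit_square"
  shows "winding_number (\<lambda>x. H 0 (4 * x)) z = 1"
proof -
  let ?g = "\<lambda>x. H 0 (4 * x)"
  have z': "z \<notin> range (H 0)"
    using z by (simp add: range_H_0 frontier_def)
  have "path ?g"
    unfolding path_def
    by (rule continuous_on_compose2[OF continuous_on_H, of _ "\<lambda>x. (0, 4 * x)", simplified])
      (auto intro!: continuous_intros)
  moreover have "z \<notin> path_image ?g"
    using z' by (auto simp: path_image_def)
  ultimately have comb: "winding_number (subpath u v ?g) z + winding_number (subpath v w ?g) z = winding_number (subpath u w ?g) z"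
    if "u \<in> {0..1}" "v \<in> {0..1}" "w \<in> {0..1}" for u v w
    using that by (intro winding_number_subpath_combine)
  have sub: "winding_number (subpath (real j / 4) ((real j + 1) / 4) ?g) z = winding_number (linepath (E (1 + j)) (E (2 + j))) z" for j
  proof (rule winding_number_cong)
    fix x :: real assume x: "0 \<le> x" "x \<le> 1"
    have "4 * (((real j + 1) / 4 - real j / 4) * x + real j / 4) = real j + x"
      by (simp add: field_simps)
    then show "subpath (real j / 4) ((real j + 1) / 4) ?g x = linepath (E (1 + j)) (E (2 + j)) x"
      using H_0[of x j] x by (simp only: subpath_def) simp
  qed
  have "winding_number ?g z = winding_number (subpath 0 (1 / 4) ?g) z + winding_number (subpath (1 / 4) (2 / 4) ?g) z
      + winding_number (subpath (2 / 4) (3 / 4) ?g) z + winding_number (subpath (3 / 4) 1 ?g) z"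
    using comb[of 0 "1/4" "2/4"] comb[of 0 "2/4" "3/4"] comb[of 0 "3/4" 1] by simp
  also have "\<dots> = winding_number (linepath (E 1) (E 2)) z + winding_number (linepath (E 2) (E 3)) z
      + winding_number (linepath (E 3) (E 4)) z + winding_number (linepath (E 4) (E 5)) z"
    using sub[of 0] sub[of 1] sub[of 2] sub[of 3] by (simp add: eval_nat_numeral)
  also have "\<dots> = winding_number (rectpath (Complex 0 0) (Complex 1 1)) z"
  proof -
    have "z \<notin> path_image (rectpath (Complex 0 0) (Complex 1 1))"
      using z by (simp add: path_image_rectpath_cbox_minus_box unit_square_def)
    then show ?thesis
      unfolding rectpath_eq by (simp add: winding_number_join path_image_join)
  qed
  also have "\<dots> = 1"
    using z by (intro winding_number_rectpath) (simp add: unit_square_def)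
  finally show ?thesis .
qed

section \<open>Rotation numbers and the foliation\<close>

definition \<rho> :: "real \<Rightarrow> real" where
  "\<rho> r = r * w / (4 * L r)"

lemma H_eq_if_Ints: "(u - u') / 4 \<in> \<int> \<Longrightarrow> H r u = H r u'"
  using Ints_periodic[of "\<lambda>x. H r (4 * x)" "u / 4" "u' / 4"] H_periodic[of r]
  by (simp add: distrib_left diff_divide_distrib)

lemma range_H_4: "range (\<lambda>x. H r (4 * x)) = range (H r)"
proof -
  have "H r u \<in> range (\<lambda>x. H r (4 * x))" for u
    by (rule image_eqI[of _ _ "u / 4"]) auto
  then show ?thesis by auto
qed

sublocale leaves: symmetric_leaves F "\<lambda>r x. H r (4 * x)" \<rho>
proof
  show "continuous_on ({0..1} \<times> UNIV) (\<lambda>(r, x). H r (4 * x))"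
    using continuous_on_compose2[OF continuous_on_H, of "{0..1} \<times> UNIV" "\<lambda>p. (fst p, 4 * snd p)"]
    by (simp add: case_prod_unfold image_subset_iff continuous_intros)
  show "H r (4 * x) = H r' (4 * x') \<longleftrightarrow> r = r' \<and> x - x' \<in> \<int>"
    if "r \<in> {0..1}" "r' \<in> {0..1}" for r r' x x'
  proof -
    have quarter: "(4 * x - 4 * x') / 4 = x - x'"
      by simp
    show ?thesis
    proof
    assume eq: "H r (4 * x) = H r' (4 * x')"
    then have "r = r'"
      using H_eq_imp_le[of r r'] H_eq_imp_le[of r' r] that by (metis atLeastAtMost_iff order_antisym)
    then have "(4 * x - 4 * x') / 4 \<in> \<int>"
      using H_inj[of r "4 * x" "4 * x'"] eq that by auto
    then show "r = r' \<and> x - x' \<in> \<int>"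
      using \<open>r = r'\<close> unfolding quarter by simp
  next
    assume "r = r' \<and> x - x' \<in> \<int>"
    then show "H r (4 * x) = H r' (4 * x')"
      using H_eq_if_Ints[of "4 * x" "4 * x'" r] unfolding quarter by simp
  qed
  qed
  show "range (\<lambda>x. H 0 (4 * x)) = frontier unit_square"
    unfolding range_H_4 by (rule range_H_0)
  show "range (\<lambda>x. H r (4 * x)) \<subseteq> unit_square" if "r \<in> {0..1}" for r
  proof clarify
    fix x
    have "0 \<le> r * t"
      using that s_t by simp
    then show "H r (4 * x) \<in> unit_square"
      using H_bounds[of r "4 * x"] that by (auto simp: unit_square_def in_cbox_complex_iff)
  qed
  show "range (\<lambda>x. H 1 (4 * x)) \<subseteq> interior unit_square"
  proof clarify
    fix x
    show "H 1 (4 * x) \<in> interior unit_square"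
      using H_bounds[of 1 "4 * x"] s_t(1) by (auto simp: unit_square_def in_cbox_complex_iff in_box_complex_iff)
  qed
  show "F (H r (4 * x)) = H r (4 * (x + \<rho> r))" if "r \<in> {0..1}" for r x
    using F_H[of r "4 * x"] that by (simp add: \<rho>_def distrib_left)
  show "R (H r (4 * x)) = H r (4 * (x + 1 / 4))" for r x
    by (simp add: distrib_left H_add_1)
  show "center \<notin> range (\<lambda>x. H r (4 * x))" if "r \<in> {0..1}" for r
    using center_not_H[of r] that by (metis (no_types, lifting) atLeastAtMost_iff imageE)
qed (rule winding_number_H_0)

lemma \<rho>_props:
  shows "continuous_on {0..1} \<rho>" "mono_on {0..1} \<rho>" "\<And>r. r \<in> {0..1} \<Longrightarrow> 0 \<le> \<rho> r \<and> \<rho> r < 1"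
    "\<rho> 0 = 0" "\<rho> 1 = 1 / (4 * real K)"
proof -
  have "continuous_on {0..1} L"
    unfolding L_def by (intro continuous_intros)
  then show "continuous_on {0..1} \<rho>"
    unfolding \<rho>_def using L_pos by (intro continuous_intros) force+
  show "mono_on {0..1} \<rho>"
  proof (rule mono_onI)
    fix r r' :: real assume r: "r \<in> {0..1}" "r' \<in> {0..1}" "r \<le> r'"
    then have L: "0 < L r" "0 < L r'" using L_pos by auto
    \<comment> \<open>The terms with \<open>K\<close> cancel, so monotonicity reduces to
      \<open>r \<le> r'\<close>.\<close>
    have "r' * L r - r * L r' = r' - r"
      by (simp add: L_def algebra_simps)
    then have "w * (r * L r') \<le> w * (r' * L r)"
      using r s_t by (intro mult_left_mono) auto
    then have "w * (r * L r') / (4 * (L r * L r')) \<le> w * (r' * L r) / (4 * (L r * L r'))"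
      using L by (intro divide_right_mono) auto
    then show "\<rho> r \<le> \<rho> r'"
      using L by (simp add: \<rho>_def mult.commute)
  qed
  show "0 \<le> \<rho> r \<and> \<rho> r < 1" if "r \<in> {0..1}" for r
    using that L_pos[of r] rw_le_L[of r] s_t by (auto simp: \<rho>_def)
  show "\<rho> 0 = 0" by (simp add: \<rho>_def)
  show "\<rho> 1 = 1 / (4 * real K)"
    using s_t K by (simp add: \<rho>_def L_def)
qed

section \<open>The innermost leaf\<close>

text \<open>For \<open>r = 1\<close> a quarter consists of exactly \<open>K\<close> edges of equal
  duration, the last being \<open>e K\<close>.\<close>

lemma H_1_affine:
  assumes x: "0 \<le> x" "x \<le> 1"
  shows "H 1 ((of_int m + x) / real K) = (1 - x) *\<^sub>R H 1 (of_int m / real K) + x *\<^sub>R H 1 ((of_int m + 1) / real K)"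
proof -
  \<comment> \<open>\<open>n\<close> counts the quarters and \<open>k\<close> the edges within the
    quarter.\<close>
  define n k where "n = m div int K" and "k = nat (m mod int K)"
  have m: "of_int m = of_int n * real K + real k"
  proof -
    have "m = n * int K + int k"
      using K by (simp add: n_def k_def)
    then show ?thesis by simp
  qed
  have k: "k < K"
    using K by (simp add: k_def nat_less_iff)
  define a b where "a = (R ^^ nat (n mod 4)) (v (Suc k))" and "b = (R ^^ nat (n mod 4)) (v (Suc (Suc k)))"
  have H: "H 1 ((of_int m + y) / real K) = (1 - y) *\<^sub>R a + y *\<^sub>R b" if y: "0 \<le> y" "y \<le> 1" for y
  proof -
    have u: "(of_int m + y) / real K = of_int n + (real k + y) / real K"
      using K by (simp add: m add_divide_distrib)
    have "0 \<le> (real k + y) / real K" "(real k + y) / real K \<le> 1"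
      using k y K by (auto simp: divide_le_eq)
    then have "H 1 ((of_int m + y) / real K) = (R ^^ nat (n mod 4)) (\<gamma> 1 ((real k + y) / real K * L 1))"
      unfolding u by (subst H_interval[of 1 _ n]) auto
    also have "(real k + y) / real K * L 1 = (real k + y) * (1 * w)"
      using K by (simp add: L_def)
    also have "\<gamma> 1 \<dots> = 1 *\<^sub>R ((1 - y) *\<^sub>R v (Suc k) + y *\<^sub>R v (Suc (Suc k)))"
      using k K_M y by (intro \<gamma>_edge) auto
    also have "\<dots> = (1 - y) *\<^sub>R v (Suc k) + y *\<^sub>R v (Suc (Suc k)) + 0 *\<^sub>R 0"
      by simp
    also have "(R ^^ nat (n mod 4)) \<dots> = (1 - y) *\<^sub>R a + y *\<^sub>R b"
      by (subst R_pow_affine) (simp_all add: a_def b_def)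
    finally show ?thesis .
  qed
  show ?thesis
    using H[OF x] H[of 0] H[of 1] by simp
qed

text \<open>The parametrization starts at \<open>v 1\<close>, so \<open>v 0\<close> comes one edge
  earlier, at the end of the preceding quarter; its rotated copy is \<open>v K\<close>.\<close>

lemma P_4_H: "P \<theta> 4 = H 1 (- 1 / real K)"
proof -
  have "R (H 1 (- 1 / real K)) = H 1 (- 1 / real K + 1)"
    by (rule H_add_1[symmetric])
  also have "- 1 / real K + 1 = real M / real K"
    using K by (simp add: K_M(3) field_simps)
  also have "H 1 \<dots> = \<gamma> 1 (real M / real K * L 1)"
    using K by (intro H_unit) (auto simp: K_M(3))
  also have "real M / real K * L 1 = (real M + 0) * (1 * w)"
    using K by (simp add: L_def)
  also have "\<gamma> 1 \<dots> = v K"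
    by (subst \<gamma>_edge) (simp_all add: K_M(1))
  also have "\<dots> = R (P \<theta> 4)"
    unfolding v_K by (simp add: vertices complex_eq_iff)
  finally show ?thesis
    using R_pow_cong[of 1] by simp
qed

lemma F_pow_P_4: "(F ^^ i) (P \<theta> 4) = H 1 ((real i - 1) / real K)"
proof (induction i)
  case (Suc i)
  have "F (H 1 ((real i - 1) / real K)) = H 1 ((real i - 1) / real K + 1 * w / L 1)"
    by (rule F_H) auto
  also have "(real i - 1) / real K + 1 * w / L 1 = (real (Suc i) - 1) / real K"
    using K s_t(3) by (simp add: L_def field_simps)
  finally show ?case
    using Suc by simp
qed (use P_4_H in simp)

text \<open>Segment \<open>i\<close> has the parameters from \<open>(i - 1) / K\<close> to
  \<open>i / K\<close>, and these \<open>4 * K\<close> intervals tile a period of length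
  \<open>4\<close>.\<close>

lemma Gamma0_eq: "Gamma0 F \<theta> K = range (H 1)"
proof -
  have seg: "closed_segment ((F ^^ i) (P \<theta> 4)) ((F ^^ (i + 1)) (P \<theta> 4))
      = (\<lambda>x. H 1 ((of_int (int i - 1) + x) / real K)) ` {0..1}" for i
  proof -
    have "closed_segment ((F ^^ i) (P \<theta> 4)) ((F ^^ (i + 1)) (P \<theta> 4))
        = linepath (H 1 (of_int (int i - 1) / real K)) (H 1 ((of_int (int i - 1) + 1) / real K)) ` {0..1}"
      unfolding linepath_image_01 by (simp add: F_pow_P_4 del: funpow.simps)
    also have "\<dots> = (\<lambda>x. H 1 ((of_int (int i - 1) + x) / real K)) ` {0..1}"
      unfolding linepath_def by (intro image_cong refl H_1_affine[symmetric]) auto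
    finally show ?thesis .
  qed
  show ?thesis
  proof
    show "Gamma0 F \<theta> K \<subseteq> range (H 1)"
      unfolding Gamma0_def seg by blast
    show "range (H 1) \<subseteq> Gamma0 F \<theta> K"
    proof clarify
      fix u
      \<comment> \<open>The distance of \<open>u\<close> from the initial parameter
        \<open>- 1 / K\<close>, reduced modulo the period \<open>4\<close>.\<close>
      define y where "y = 4 * frac ((u + 1 / real K) / 4)"
      define i where "i = nat \<lfloor>y * real K\<rfloor>"
      have y: "0 \<le> y" "y < 4"
        using frac_lt_1[of "(u + 1 / real K) / 4"] by (simp_all add: y_def)
      have yK: "0 \<le> y * real K" "y * real K < 4 * real K"
        using y K by auto
      have "i < 4 * K"
        using yK K by (simp add: i_def nat_less_iff floor_less_iff)
      then have i: "i \<in> {0..4 * K - 1}"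
        by simp
      have "(u - (y - 1 / real K)) / 4 = of_int \<lfloor>(u + 1 / real K) / 4\<rfloor>"
        by (simp add: y_def frac_def field_simps)
      then have "H 1 u = H 1 (y - 1 / real K)"
        by (intro H_eq_if_Ints) simp
      also have "y - 1 / real K = (of_int (int i - 1) + frac (y * real K)) / real K"
        using K yK by (simp add: i_def frac_def field_simps)
      finally have "H 1 u \<in> (\<lambda>x. H 1 ((of_int (int i - 1) + x) / real K)) ` {0..1}"
        using frac_lt_1[of "y * real K"] by (auto simp: less_imp_le)
      then show "H 1 u \<in> Gamma0 F \<theta> K"
        unfolding Gamma0_def seg using i by blast
    qed
  qed
qed

lemma P_in_Gamma0: "P \<theta> i \<in> Gamma0 F \<theta> K" "P' \<theta> i \<in> Gamma0 F \<theta> K"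
proof -
  have "P \<theta> i = (R ^^ i) (P \<theta> 4)"
    using R_pow_P[of i \<theta> 0] by (simp add: vertices)
  also have "\<dots> = H 1 (- 1 / real K + real i)"
    unfolding P_4_H H_add_nat ..
  finally show "P \<theta> i \<in> Gamma0 F \<theta> K"
    unfolding Gamma0_eq by simp
  have "H 1 0 = P' \<theta> 0"
    using H_unit[of 0 1] \<gamma>_0[of 1] v_1 by (simp add: vertices)
  then have "P' \<theta> i = H 1 (0 + real i)"
    unfolding H_add_nat using R_pow_P'[of i \<theta> 0] by simp
  then show "P' \<theta> i \<in> Gamma0 F \<theta> K"
    unfolding Gamma0_eq by simp
qed

end

theorem corollary5p4:
  fixes K :: nat and \<theta> :: real and F :: "complex \<Rightarrow> complex"
  assumes "K \<ge> 3"
    and "0 < \<theta>" and "\<theta> < pi / 4"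
    and "is_F \<theta> F"
    and "\<And>k. k < K \<Longrightarrow> (F ^^ k) ` closed_segment (E 1) (P \<theta> 4) \<subseteq> triangle_B \<theta> 1"
    and "(F ^^ K) ` closed_segment (E 1) (P \<theta> 4) = closed_segment (E 1) (P \<theta> 1)"
  shows "rotationally_symmetric_circle F (Gamma0 F \<theta> K) \<and>
         (\<forall>i\<in>{1..4}. P \<theta> i \<in> Gamma0 F \<theta> K \<and> P' \<theta> i \<in> Gamma0 F \<theta> K) \<and>
         completely_foliated F (Gamma0 F \<theta> K) 0 (1 / (4 * real K))"
proof -
  interpret integrable_zone K \<theta> F
    using assms by unfold_locales
  have "Gamma0 F \<theta> K = range (\<lambda>x. H 1 (4 * x))"
    by (simp add: Gamma0_eq range_H_4)
  then show ?thesis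
    using leaves.rotationally_symmetric_leaf[of 1] leaves.completely_foliated_leaves[OF \<rho>_props(1-3)]
      P_in_Gamma0 \<rho>_props(4,5) by auto
qed

end
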